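(* There exists a punctual structure $A$ which is computably categorical but not punctually categorical, such that $\mathrm{PRCatSpec}(A)\nsubseteq\mathrm{Cone}(\Delta^0_1)$.
   Context: A punctual structure is a structure with domain $\omega$ whose operations and relations are uniformly primitive recursive. A computable structure $A$ is computably categorical if between any two computable presentations of $A$ there is a computable isomorphism. Two punctual structures are punctually isomorphic if there is an isomorphism $f$ between them such that both $f$ and $f^{-1}$ are primitive recursive; a punctual structure $A$ is punctually categorical if every punctual structure $B\cong A$ is punctually isomorphic to $A$. For total functions $f,g:\omega\to\omega$, write $f\leq_{PR} g$ if there is a primitive recursive scheme $\Psi$ (a primitive recursive definition which may additionally use the oracle function as a basic function) with $\Psi^{g}=f$. Write $f\equiv_{PR}g$ if $f\leq_{PR}g$ and $g\leq_{PR}f$. The $\equiv_{PR}$-classes are the PR-degrees, ordered by $\leq_{PR}$. For a punctual structure $A$, $\mathrm{PRCatSpec}(A)$ is the set of all PR-degrees $\mathbf d$ such that for every punctual structure $B\cong A$ there is an isomorphism $f:A\to B$ with $f\leq_{PR}\mathbf d$ and $f^{-1}\leq_{PR}\mathbf d$. $\mathrm{Cone}(\Delta^0_1)$ is the set of all PR-degrees $\mathbf d$ such that $f\leq_{PR}\mathbf d$ for every total $\Delta^0_1$ (i.e. computable) function $f:\omega\to\omega$. *)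

theory Defs
  imports Main "HOL-Library.Nat_Bijection"
begin

text \<open>
  Schemes built from the usual basic functions, a unary oracle, composition, primitive
  recursion and minimization; the primitive recursive ones are those without minimization.
\<close>

datatype scheme =
    ZeroS | SuccS | ProjS nat | OracleS
  | CompS scheme "scheme list"
  | RecS scheme scheme
  | MuS scheme

fun mu_free :: "scheme \<Rightarrow> bool" where
  "mu_free ZeroS = True"
| "mu_free SuccS = True"
| "mu_free (ProjS i) = True"
| "mu_free OracleS = True"
| "mu_free (CompS p qs) = (mu_free p \<and> (\<forall>q\<in>set qs. mu_free q))"
| "mu_free (RecS p q) = (mu_free p \<and> mu_free q)"
| "mu_free (MuS p) = False"

fun oracle_free :: "scheme \<Rightarrow> bool" where
  "oracle_free ZeroS = True"
| "oracle_free SuccS = True"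
| "oracle_free (ProjS i) = True"
| "oracle_free OracleS = False"
| "oracle_free (CompS p qs) = (oracle_free p \<and> (\<forall>q\<in>set qs. oracle_free q))"
| "oracle_free (RecS p q) = (oracle_free p \<and> oracle_free q)"
| "oracle_free (MuS p) = oracle_free p"

text \<open>
  \<open>evals g p xs y\<close>: the scheme \<open>p\<close> with oracle \<open>g\<close>, applied to the tuple \<open>xs\<close>, converges with
  value \<open>y\<close>. Arities are not tracked separately: an application with the wrong number of
  arguments has no value. In \<open>RecS\<close> and \<open>MuS\<close> the active variable comes first.
\<close>

inductive evals :: "(nat \<Rightarrow> nat) \<Rightarrow> scheme \<Rightarrow> nat list \<Rightarrow> nat \<Rightarrow> bool" for g where
  zero: "evals g ZeroS xs 0"
| succ: "evals g SuccS [x] (Suc x)"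
| proj: "i < length xs \<Longrightarrow> evals g (ProjS i) xs (xs ! i)"
| oracle_call: "evals g OracleS [x] (g x)"
| comp: "list_all2 (\<lambda>q y. evals g q xs y) qs ys \<Longrightarrow> evals g p ys z
    \<Longrightarrow> evals g (CompS p qs) xs z"
| rec_zero: "evals g p xs y \<Longrightarrow> evals g (RecS p q) (0 # xs) y"
| rec_suc: "evals g (RecS p q) (n # xs) r \<Longrightarrow> evals g q (n # r # xs) y
    \<Longrightarrow> evals g (RecS p q) (Suc n # xs) y"
| mu: "evals g p (n # xs) 0 \<Longrightarrow> \<forall>m<n. \<exists>k. evals g p (m # xs) (Suc k)
    \<Longrightarrow> evals g (MuS p) xs n"

lemma evals_deterministic:
  "evals g p xs y \<Longrightarrow> evals g p xs z \<Longrightarrow> y = z"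
proof (induction arbitrary: z rule: evals.induct)
  case (comp xs qs ys p w)
  from comp.prems obtain ys' where
    ys': "list_all2 (\<lambda>q y. evals g q xs y) qs ys'" "evals g p ys' z"
    by (cases rule: evals.cases) auto
  have "ys = ys'"
    using comp.IH(1) ys'(1)
    unfolding list_all2_conv_all_nth by (intro nth_equalityI) auto
  with comp.IH(2) ys'(2) show ?case by blast
next
  case (mu p n xs)
  from mu.prems obtain z0: "evals g p (z # xs) 0" 
    and zl: "\<forall>m<z. \<exists>k. evals g p (m # xs) (Suc k)"
    by (cases rule: evals.cases) auto
  show ?case
  proof (rule linorder_cases[of n z])
    assume "n < z"
    then show ?thesis using zl mu.IH(1) by fastforce
  next
    assume "z < n"
    then show ?thesis using mu.IH(2) z0 by fastforce
  qed
next
  case (rec_suc p q n xs r y)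
  from rec_suc.prems obtain r' where
    "evals g (RecS p q) (n # xs) r'" "evals g q (n # r' # xs) z"
    by (cases rule: evals.cases) auto
  with rec_suc.IH show ?case by blast
next
  case (rec_zero p xs y q)
  from rec_zero.prems have "evals g p xs z"
    by (cases rule: evals.cases) auto
  with rec_zero.IH show ?case by blast
next
  case (zero xs)
  from zero.prems show ?case by (cases rule: evals.cases) auto
next
  case (succ x)
  from succ.prems show ?case by (cases rule: evals.cases) auto
next
  case (proj i xs)
  from proj.prems show ?case by (cases rule: evals.cases) auto
next
  case (oracle_call x)
  from oracle_call.prems show ?case by (cases rule: evals.cases) auto
qed

definition primrec_fun :: "(nat \<Rightarrow> nat) \<Rightarrow> bool" where
  "primrec_fun f \<longleftrightarrow>
     (\<exists>p. mu_free p \<and> oracle_free p \<and> (\<forall>x. evals (\<lambda>_. 0) p [x] (f x)))"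

definition computable_fun :: "(nat \<Rightarrow> nat) \<Rightarrow> bool" where
  "computable_fun f \<longleftrightarrow> (\<exists>p. oracle_free p \<and> (\<forall>x. evals (\<lambda>_. 0) p [x] (f x)))"

definition pr_le :: "(nat \<Rightarrow> nat) \<Rightarrow> (nat \<Rightarrow> nat) \<Rightarrow> bool"  (infix \<open>\<le>\<^sub>P\<^sub>R\<close> 50) where
  "f \<le>\<^sub>P\<^sub>R g \<longleftrightarrow> (\<exists>p. mu_free p \<and> (\<forall>x. evals g p [x] (f x)))"

definition pr_equiv :: "((nat \<Rightarrow> nat) \<times> (nat \<Rightarrow> nat)) set" where
  "pr_equiv = {(f, g). f \<le>\<^sub>P\<^sub>R g \<and> g \<le>\<^sub>P\<^sub>R f}"

text \<open>Substituting a scheme for the oracle, for transitivity of the reducibility.\<close>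

fun oracle_subst :: "scheme \<Rightarrow> scheme \<Rightarrow> scheme" where
  "oracle_subst q OracleS = q"
| "oracle_subst q (CompS p ps) = CompS (oracle_subst q p) (map (oracle_subst q) ps)"
| "oracle_subst q (RecS p p') = RecS (oracle_subst q p) (oracle_subst q p')"
| "oracle_subst q (MuS p) = MuS (oracle_subst q p)"
| "oracle_subst q p = p"

lemma mu_free_oracle_subst:
  "mu_free q \<Longrightarrow> mu_free p \<Longrightarrow> mu_free (oracle_subst q p)"
  by (induction p) auto

lemma evals_oracle_subst:
  assumes "\<forall>x. evals h q [x] (g x)"
  shows "evals g p xs y \<Longrightarrow> evals h (oracle_subst q p) xs y"
proof (induction rule: evals.induct)
  case (comp xs qs ys p z)
  have "list_all2 (\<lambda>q y. evals h q xs y) (map (oracle_subst q) qs) ys"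
    using comp.IH(1) by (simp add: list_all2_conv_all_nth)
  with comp.IH(2) show ?case by (auto intro: evals.comp)
next
  case (mu p n xs)
  then show ?case by (auto intro!: evals.mu)
qed (use assms in \<open>auto intro: evals.intros\<close>)

lemma equiv_pr_equiv: "equiv UNIV pr_equiv"
proof (rule equivI)
  have "f \<le>\<^sub>P\<^sub>R f" for f
    unfolding pr_le_def by (rule exI[of _ OracleS]) (auto intro: evals.intros)
  then show "refl pr_equiv" by (auto simp: refl_on_def pr_equiv_def)
  show "sym pr_equiv" by (auto simp: sym_def pr_equiv_def)
  have "f \<le>\<^sub>P\<^sub>R h" if "f \<le>\<^sub>P\<^sub>R g" "g \<le>\<^sub>P\<^sub>R h" for f g h
    using that unfolding pr_le_def by (meson evals_oracle_subst mu_free_oracle_subst)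
  then show "trans pr_equiv" unfolding trans_def pr_equiv_def by blast
qed auto

definition pr_degrees :: "(nat \<Rightarrow> nat) set set" where
  "pr_degrees = UNIV // pr_equiv"

definition pr_le_degree :: "(nat \<Rightarrow> nat) \<Rightarrow> (nat \<Rightarrow> nat) set \<Rightarrow> bool" where
  "pr_le_degree f d \<longleftrightarrow> (\<exists>g\<in>d. f \<le>\<^sub>P\<^sub>R g)"

definition cone_Delta01 :: "(nat \<Rightarrow> nat) set set" where
  "cone_Delta01 = {d \<in> pr_degrees. \<forall>f. computable_fun f \<longrightarrow> pr_le_degree f d}"

text \<open>Languages may be finite or infinite; constants are function symbols of arity 0.\<close>

record lang =
  fun_syms :: "nat set"
  rel_syms :: "nat set"
  fun_arity :: "nat \<Rightarrow> nat"
  rel_arity :: "nat \<Rightarrow> nat"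

definition primrec_lang :: "lang \<Rightarrow> bool" where
  "primrec_lang L \<longleftrightarrow>
     primrec_fun (\<lambda>i. of_bool (i \<in> fun_syms L)) \<and> primrec_fun (\<lambda>i. of_bool (i \<in> rel_syms L)) \<and>
     primrec_fun (fun_arity L) \<and> primrec_fun (rel_arity L)"

text \<open>
  The domain is all of \<open>nat\<close>. Only interpretations of symbols of the language at tuples of the
  right length carry meaning; everything below ignores the other values.
\<close>

record struc =
  fun_int :: "nat \<Rightarrow> nat list \<Rightarrow> nat"
  rel_int :: "nat \<Rightarrow> nat list \<Rightarrow> bool"

text \<open>
  All operations and relations are given by two functions from the class \<open>C\<close>, uniformly in the
  symbol, a symbol together with its arguments being coded as a single number.
\<close>

definition uniformly_presented :: "((nat \<Rightarrow> nat) \<Rightarrow> bool) \<Rightarrow> lang \<Rightarrow> struc \<Rightarrow> bool" where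
  "uniformly_presented C L A \<longleftrightarrow>
     (\<exists>\<phi>. C \<phi> \<and> (\<forall>i\<in>fun_syms L. \<forall>xs. length xs = fun_arity L i \<longrightarrow>
        fun_int A i xs = \<phi> (list_encode (i # xs)))) \<and>
     (\<exists>\<rho>. C \<rho> \<and> (\<forall>i\<in>rel_syms L. \<forall>xs. length xs = rel_arity L i \<longrightarrow>
        of_bool (rel_int A i xs) = \<rho> (list_encode (i # xs))))"

definition punctual :: "lang \<Rightarrow> struc \<Rightarrow> bool" where
  "punctual L A \<longleftrightarrow> uniformly_presented primrec_fun L A"

definition computable_struc :: "lang \<Rightarrow> struc \<Rightarrow> bool" where
  "computable_struc L A \<longleftrightarrow> uniformly_presented computable_fun L A"

definition isomorphism :: "lang \<Rightarrow> struc \<Rightarrow> struc \<Rightarrow> (nat \<Rightarrow> nat) \<Rightarrow> bool" where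
  "isomorphism L A B f \<longleftrightarrow> bij f \<and>
     (\<forall>i\<in>fun_syms L. \<forall>xs. length xs = fun_arity L i \<longrightarrow>
        f (fun_int A i xs) = fun_int B i (map f xs)) \<and>
     (\<forall>i\<in>rel_syms L. \<forall>xs. length xs = rel_arity L i \<longrightarrow>
        (rel_int A i xs \<longleftrightarrow> rel_int B i (map f xs)))"

definition isomorphic :: "lang \<Rightarrow> struc \<Rightarrow> struc \<Rightarrow> bool" where
  "isomorphic L A B \<longleftrightarrow> (\<exists>f. isomorphism L A B f)"

definition computably_categorical :: "lang \<Rightarrow> struc \<Rightarrow> bool" where
  "computably_categorical L A \<longleftrightarrow>
     (\<forall>B C. computable_struc L B \<and> isomorphic L A B \<and> computable_struc L C \<and> isomorphic L A C
        \<longrightarrow> (\<exists>f. isomorphism L B C f \<and> computable_fun f))"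

definition punctually_isomorphic :: "lang \<Rightarrow> struc \<Rightarrow> struc \<Rightarrow> bool" where
  "punctually_isomorphic L A B \<longleftrightarrow>
     (\<exists>f. isomorphism L A B f \<and> primrec_fun f \<and> primrec_fun (inv f))"

definition punctually_categorical :: "lang \<Rightarrow> struc \<Rightarrow> bool" where
  "punctually_categorical L A \<longleftrightarrow>
     (\<forall>B. punctual L B \<and> isomorphic L A B \<longrightarrow> punctually_isomorphic L A B)"

definition PRCatSpec :: "lang \<Rightarrow> struc \<Rightarrow> (nat \<Rightarrow> nat) set set" where
  "PRCatSpec L A = {d \<in> pr_degrees.
     \<forall>B. punctual L B \<and> isomorphic L A B \<longrightarrow>
       (\<exists>f. isomorphism L A B f \<and> pr_le_degree f d \<and> pr_le_degree (inv f) d)}"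

end

theory Submission
  imports Defs "HOL-Library.Infinite_Set"
begin

text \<open>
  A function \<open>dbit\<close> with values in \<open>{0, 1}\<close> is built that diagonalises against all primitive
  recursive predictions of it. Every element \<open>x\<close> of the structure \<open>A\<close> has a type \<open>n\<close>: unary
  relations answer, for every \<open>j\<close>, whether \<open>j < n\<close>, and if so reveal \<open>dbit j\<close>. Each type \<open>n > 0\<close> is
  realised exactly once, type \<open>0\<close> infinitely often, and the \<open>i\<close>-th constant names the element of
  type \<open>slow i\<close>, where \<open>slow\<close> is a slowly growing primitive recursive function.

  In a punctual copy an element of large type predicts many values of \<open>dbit\<close>. By diagonalisation
  the types in a punctual copy therefore have a primitive recursive bound, and so has the search
  for elements of type \<open>0\<close>. Elements of type \<open>n > 0\<close> are found through their constants, so all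
  isomorphisms between punctual copies are primitive recursive in the modulus
  \<open>slow_time n = (LEAST i. n \<le> slow i)\<close>, a single computable function, which does not bound all
  computable functions. The copy in which elements of positive type appear as early as their
  bits can be computed, and the one in which they appear when \<open>slow\<close> increases, are not punctually
  isomorphic if \<open>slow\<close> is slow enough.
\<close>

section \<open>Pairing of natural numbers\<close>

definition pair :: "nat \<Rightarrow> nat \<Rightarrow> nat" where "pair x y = prod_encode (x, y)"
definition pfst :: "nat \<Rightarrow> nat" where "pfst z = fst (prod_decode z)"
definition psnd :: "nat \<Rightarrow> nat" where "psnd z = snd (prod_decode z)"

lemma pfst_pair [simp]: "pfst (pair x y) = x"
  and psnd_pair [simp]: "psnd (pair x y) = y"
  and pair_pfst_psnd [simp]: "pair (pfst z) (psnd z) = z"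
  by (auto simp: pair_def pfst_def psnd_def)

lemma list_encode_Cons_pair: "list_encode (x # xs) = Suc (pair x (list_encode xs))"
  by (simp add: pair_def)

lemma le_pair_1: "x \<le> pair x y" and le_pair_2: "y \<le> pair x y"
  by (auto simp: pair_def le_prod_encode_1 le_prod_encode_2)

lemma psnd_less:
  assumes "0 < pfst z"
  shows "psnd z < z"
proof -
  have "psnd z < pfst z + psnd z" using assms by simp
  also have "\<dots> \<le> triangle (pfst z + psnd z) + pfst z"
  proof -
    have "n \<le> triangle n" for n by (induction n) auto
    then show ?thesis by (simp add: trans_le_add1)
  qed
  also have "\<dots> = pair (pfst z) (psnd z)" by (simp only: pair_def prod_encode_def) simp
  finally show ?thesis by simp
qed

lemma pfst_le: "pfst z \<le> z" and psnd_le: "psnd z \<le> z"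
  using le_pair_1[of "pfst z" "psnd z"] le_pair_2[of "psnd z" "pfst z"] by simp_all

lemma evals_oracle_free:
  "evals g p xs y \<Longrightarrow> oracle_free p \<Longrightarrow> evals g' p xs y"
proof (induction rule: evals.induct)
  case (comp xs qs ys p z)
  have "list_all2 (\<lambda>q y. evals g' q xs y) qs ys"
    using comp.IH(1) comp.prems by (auto simp: list_all2_conv_all_nth)
  with comp show ?case by (auto intro: evals.comp)
next
  case (mu p n xs)
  then show ?case by (auto intro!: evals.mu)
qed (auto intro: evals.intros)

section \<open>Functions computed by a class of schemes\<close>

named_theorems unary_intros

text \<open>Primitive recursive functions, computable functions and functions primitive recursive in
  an oracle share the closure properties that follow from these three conditions, so these are
  proved once and instantiated for each class.\<close>

locale scheme_class =
  fixes K :: "scheme \<Rightarrow> bool" and g :: "nat \<Rightarrow> nat"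
  assumes K_base: "mu_free p \<Longrightarrow> oracle_free p \<Longrightarrow> K p"
    and K_comp: "K p \<Longrightarrow> (\<And>q. q \<in> set qs \<Longrightarrow> K q) \<Longrightarrow> K (CompS p qs)"
    and K_rec: "K p \<Longrightarrow> K q \<Longrightarrow> K (RecS p q)"
begin

definition nary :: "nat \<Rightarrow> (nat list \<Rightarrow> nat) \<Rightarrow> bool" where
  "nary n f \<longleftrightarrow> (\<exists>p. K p \<and> (\<forall>xs. length xs = n \<longrightarrow> evals g p xs (f xs)))"

definition unary :: "(nat \<Rightarrow> nat) \<Rightarrow> bool" where
  "unary f \<longleftrightarrow> (\<exists>p. K p \<and> (\<forall>x. evals g p [x] (f x)))"

definition binary :: "(nat \<Rightarrow> nat \<Rightarrow> nat) \<Rightarrow> bool" where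
  "binary f \<longleftrightarrow> nary 2 (\<lambda>xs. f (xs ! 0) (xs ! 1))"

lemma unary_iff_nary: "unary f \<longleftrightarrow> nary 1 (\<lambda>xs. f (xs ! 0))"
proof
  assume "unary f"
  then obtain p where "K p" "\<forall>x. evals g p [x] (f x)" by (auto simp: unary_def)
  then show "nary 1 (\<lambda>xs. f (xs ! 0))"
    by (auto simp: nary_def length_Suc_conv intro!: exI[of _ p])
next
  assume "nary 1 (\<lambda>xs. f (xs ! 0))"
  then obtain p where "K p" "\<forall>xs. length xs = 1 \<longrightarrow> evals g p xs (f (xs ! 0))"
    by (auto simp: nary_def)
  then show "unary f"
    unfolding unary_def by (intro exI[of _ p]) (metis length_Cons list.size(3) nth_Cons_0 One_nat_def)
qed

lemma nary_cong: "nary n f \<Longrightarrow> (\<And>xs. length xs = n \<Longrightarrow> f xs = f' xs) \<Longrightarrow> nary n f'"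
  by (auto simp: nary_def)

lemma nary_comp:
  assumes "nary (length fs) h" "\<And>f. f \<in> set fs \<Longrightarrow> nary n f"
  shows "nary n (\<lambda>xs. h (map (\<lambda>f. f xs) fs))"
proof -
  obtain p where p: "K p" "\<And>xs. length xs = length fs \<Longrightarrow> evals g p xs (h xs)"
    using assms(1) by (auto simp: nary_def)
  have "\<forall>f\<in>set fs. \<exists>q. K q \<and> (\<forall>xs. length xs = n \<longrightarrow> evals g q xs (f xs))"
    using assms(2) by (auto simp: nary_def)
  then obtain q where q: "\<forall>f\<in>set fs. K (q f) \<and> (\<forall>xs. length xs = n \<longrightarrow> evals g (q f) xs (f xs))"
    by metis
  have "evals g (CompS p (map q fs)) xs (h (map (\<lambda>f. f xs) fs))" if "length xs = n" for xs
    using q that by (intro evals.comp[of _ _ _ "map (\<lambda>f. f xs) fs"] p)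
      (auto simp: list_all2_conv_all_nth)
  moreover have "K (CompS p (map q fs))" using p q by (auto intro!: K_comp)
  ultimately show ?thesis unfolding nary_def by blast
qed

lemma nary_unary:
  assumes "unary h" "nary n f" shows "nary n (\<lambda>xs. h (f xs))"
  using nary_comp[of "[f]" "\<lambda>xs. h (xs ! 0)" n] assms by (simp add: unary_iff_nary)

lemma nary_binary:
  assumes "binary h" "nary n f" "nary n f'" shows "nary n (\<lambda>xs. h (f xs) (f' xs))"
  using nary_comp[of "[f, f']" "\<lambda>xs. h (xs ! 0) (xs ! 1)" n] assms 
  by (auto simp add: binary_def numeral_2_eq_2)

lemma nary_proj: "i < n \<Longrightarrow> nary n (\<lambda>xs. xs ! i)"
  unfolding nary_def by (intro exI[of _ "ProjS i"]) (auto intro!: K_base evals.proj)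

lemma unary_Suc0: "unary Suc"
  unfolding unary_def by (intro exI[of _ SuccS]) (auto intro!: K_base evals.succ)

lemma nary_const: "nary n (\<lambda>xs. c)"
proof (induction c)
  case 0
  show ?case
    unfolding nary_def by (intro exI[of _ ZeroS]) (auto intro!: K_base evals.zero)
next
  case (Suc c)
  from nary_unary[OF unary_Suc0 this] show ?case .
qed

lemma nary_rec:
  assumes s: "nary n s" and a: "nary n a"
    and b: "nary (n + 2) (\<lambda>ys. b (ys ! 0) (ys ! 1) (drop 2 ys))"
  shows "nary n (\<lambda>xs. rec_nat (a xs) (\<lambda>k r. b k r xs) (s xs))"
proof -
  obtain pa where pa: "K pa" "\<And>xs. length xs = n \<Longrightarrow> evals g pa xs (a xs)"
    using a by (auto simp: nary_def)
  obtain pb where pb: "K pb"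
      "\<And>ys. length ys = n + 2 \<Longrightarrow> evals g pb ys (b (ys ! 0) (ys ! 1) (drop 2 ys))"
    using b by (auto simp: nary_def)
  have rec: "evals g (RecS pa pb) (m # xs) (rec_nat (a xs) (\<lambda>k r. b k r xs) m)"
    if "length xs = n" for m xs
  proof (induction m)
    case 0
    show ?case using pa(2)[OF that] by (auto intro: evals.rec_zero)
  next
    case (Suc m)
    let ?r = "rec_nat (a xs) (\<lambda>k r. b k r xs) m"
    show ?case
      using pb(2)[of "m # ?r # xs"] that Suc by (auto intro!: evals.rec_suc)
  qed
  \<comment> \<open>\<open>RecS\<close> expects the counter in front of the parameters:
    \<open>s\<close> supplies the counter and projections hand the parameters on unchanged.\<close>
  have "nary (length (s # map (\<lambda>i xs. xs ! i) [0..<n]))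
      (\<lambda>ys. rec_nat (a (tl ys)) (\<lambda>k r. b k r (tl ys)) (hd ys))"
    unfolding nary_def
  proof (intro exI[of _ "RecS pa pb"] conjI allI impI)
    show "K (RecS pa pb)" using pa(1) pb(1) by (rule K_rec)
    fix ys :: "nat list"
    assume "length ys = length (s # map (\<lambda>i xs. xs ! i) [0..<n])"
    then obtain m xs where "ys = m # xs" "length xs = n" by (auto simp: length_Suc_conv)
    then show "evals g (RecS pa pb) ys (rec_nat (a (tl ys)) (\<lambda>k r. b k r (tl ys)) (hd ys))"
      using rec by simp
  qed
  moreover have "nary n f" if "f \<in> set (s # map (\<lambda>i xs. xs ! i) [0..<n])" for f
    using that s by (auto intro: nary_proj)
  ultimately have "nary n (\<lambda>xs. (\<lambda>ys. rec_nat (a (tl ys)) (\<lambda>k r. b k r (tl ys)) (hd ys))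
      (map (\<lambda>f. f xs) (s # map (\<lambda>i xs. xs ! i) [0..<n])))"
    by (rule nary_comp)
  then have "nary n (\<lambda>xs. rec_nat (a (map (\<lambda>i. xs ! i) [0..<n])) (\<lambda>k r. b k r (map (\<lambda>i. xs ! i) [0..<n])) (s xs))"
    by (simp add: comp_def)
  then show ?thesis
    by (rule nary_cong) (metis map_nth)
qed

section \<open>Closure properties of unary functions\<close>

lemma unary_id [unary_intros]: "unary (\<lambda>x. x)"
  by (simp add: unary_iff_nary nary_proj)

lemma unary_const [unary_intros]: "unary (\<lambda>x. c)"
  by (simp add: unary_iff_nary nary_const)

lemma unary_comp: "unary h \<Longrightarrow> unary f \<Longrightarrow> unary (\<lambda>x. h (f x))"
  using nary_unary[of h 1 "\<lambda>xs. f (xs ! 0)"] by (simp add: unary_iff_nary)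

lemma unary_binary: "binary h \<Longrightarrow> unary f \<Longrightarrow> unary f' \<Longrightarrow> unary (\<lambda>x. h (f x) (f' x))"
  using nary_binary[of h 1 "\<lambda>xs. f (xs ! 0)" "\<lambda>xs. f' (xs ! 0)"] by (simp add: unary_iff_nary)

lemmas unary_Suc [unary_intros] = unary_comp[OF unary_Suc0]

lemma binary_add: "binary (+)"
proof -
  have eq: "rec_nat y (\<lambda>k. Suc) x = x + y" for x y :: nat by (induction x) auto
  have "nary 2 (\<lambda>xs. rec_nat (xs ! 1) (\<lambda>k r. Suc r) (xs ! 0))"
    by (intro nary_rec nary_proj nary_unary[OF unary_Suc0]) auto
  then show ?thesis by (simp add: binary_def eq)
qed

lemmas nary_add = nary_binary[OF binary_add]
lemmas unary_add [unary_intros] = unary_binary[OF binary_add]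

lemma unary_pred0: "unary (\<lambda>x. x - 1)"
proof -
  have eq: "rec_nat 0 (\<lambda>k r. k) x = x - 1" for x :: nat by (induction x) auto
  have "nary 1 (\<lambda>xs. rec_nat 0 (\<lambda>k r. k) (xs ! 0))"
    by (intro nary_rec nary_proj nary_const) auto
  then show ?thesis unfolding unary_iff_nary by (simp only: eq)
qed

lemma binary_diff: "binary (-)"
proof -
  have eq: "rec_nat x (\<lambda>k r. r - 1) y = x - y" for x y :: nat by (induction y) auto
  have "nary 2 (\<lambda>xs. rec_nat (xs ! 0) (\<lambda>k r. r - 1) (xs ! 1))"
    by (intro nary_rec nary_proj nary_unary[OF unary_pred0]) auto
  then show ?thesis unfolding binary_def by (simp only: eq)
qed

lemmas unary_diff [unary_intros] = unary_binary[OF binary_diff]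

lemma unary_triangle0: "unary triangle"
proof -
  have eq: "rec_nat 0 (\<lambda>k r. Suc k + r) n = triangle n" for n by (induction n) auto
  have "nary 1 (\<lambda>xs. rec_nat 0 (\<lambda>k r. Suc k + r) (xs ! 0))"
    by (intro nary_rec nary_proj nary_const nary_add nary_unary[OF unary_Suc0]) auto
  then show ?thesis unfolding unary_iff_nary by (simp only: eq)
qed

lemmas unary_triangle [unary_intros] = unary_comp[OF unary_triangle0]

lemma binary_pair: "binary pair"
  unfolding binary_def pair_def prod_encode_def 
  by (simp, intro nary_add nary_unary[OF unary_triangle0] nary_proj) auto

lemmas nary_pair = nary_binary[OF binary_pair]
lemmas unary_pair [unary_intros] = unary_binary[OF binary_pair]

text \<open>The step function takes the coded triple of parameter, counter and previous value. With
  everything unary, the closure rules carry no arities and can be chained along the structure of a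
  term.\<close>

lemma unary_rec [unary_intros]:
  assumes "unary a" "unary (\<lambda>w. b (pfst w) (pfst (psnd w)) (psnd (psnd w)))" "unary n"
  shows "unary (\<lambda>x. rec_nat (a x) (b x) (n x))"
proof -
  have "nary 1 (\<lambda>xs. rec_nat (a (xs ! 0)) (\<lambda>k r. b (xs ! 0) k r) (n (xs ! 0)))"
  proof (intro nary_rec[where b = "\<lambda>k r xs. b (xs ! 0) k r"])
    have "nary 3 (\<lambda>xs. b (xs ! 2) (xs ! 0) (xs ! 1))"
      using nary_unary[OF assms(2), of 3 "\<lambda>xs. pair (xs ! 2) (pair (xs ! 0) (xs ! 1))"]
      by (simp add: nary_pair nary_proj)
    then show "nary (1 + 2) (\<lambda>ys. b (drop 2 ys ! 0) (ys ! 0) (ys ! 1))"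
      by (auto simp: numeral_3_eq_3 elim!: nary_cong)
  qed (use assms in \<open>simp_all add: unary_iff_nary\<close>)
  then show ?thesis by (simp add: unary_iff_nary)
qed

definition decidable :: "(nat \<Rightarrow> bool) \<Rightarrow> bool" where
  "decidable P \<longleftrightarrow> unary (\<lambda>x. of_bool (P x))"

lemma unary_if [unary_intros]:
  assumes "decidable P" "unary f" "unary f'"
  shows "unary (\<lambda>x. if P x then f x else f' x)"
proof -
  \<comment> \<open>A case distinction is a recursion of length 0 or 1 whose step is
    constant.\<close>
  have eq: "rec_nat y (\<lambda>_ _. x) (of_bool b) = (if b then x else y)" for x y :: nat and b
    by simp
  have "nary (3 + 2) (\<lambda>ys. drop 2 ys ! 0)"
    by (rule nary_cong[OF nary_proj[of 2]]) auto
  then have "nary 3 (\<lambda>xs. rec_nat (xs ! 1) (\<lambda>_ _. xs ! 0) (xs ! 2))"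
    by (intro nary_rec nary_proj) auto
  then have "nary 1 (\<lambda>xs. rec_nat (f' (xs ! 0)) (\<lambda>_ _. f (xs ! 0)) (of_bool (P (xs ! 0))))"
    using nary_comp[of "[\<lambda>xs. f (xs ! 0), \<lambda>xs. f' (xs ! 0), \<lambda>xs. of_bool (P (xs ! 0))]"
        "\<lambda>xs. rec_nat (xs ! 1) (\<lambda>_ _. xs ! 0) (xs ! 2)" 1] assms
    by (auto simp: decidable_def unary_iff_nary numeral_3_eq_3 numeral_2_eq_2)
  then show ?thesis by (simp only: eq unary_iff_nary)
qed

lemma decidable_not [unary_intros]:
  assumes "decidable P" shows "decidable (\<lambda>x. \<not> P x)"
proof -
  have eq: "of_bool (\<not> b) = 1 - (of_bool b :: nat)" for b by simp
  show ?thesis using assms unfolding decidable_def eq by (intro unary_intros)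
qed

lemma decidable_conj [unary_intros]:
  assumes "decidable P" "decidable Q" shows "decidable (\<lambda>x. P x \<and> Q x)"
proof -
  have eq: "of_bool (b \<and> c) = (if b then of_bool c else (0::nat))" for b c by simp
  show ?thesis using assms unfolding decidable_def eq
    by (intro unary_intros) (auto simp: decidable_def)
qed

lemma decidable_disj [unary_intros]:
  assumes "decidable P" "decidable Q" shows "decidable (\<lambda>x. P x \<or> Q x)"
  using decidable_not[OF decidable_conj[OF assms[THEN decidable_not]]] by simp

lemma decidable_less [unary_intros]:
  assumes "unary f" "unary f'" shows "decidable (\<lambda>x. f x < f' x)"
proof -
  have eq: "of_bool (a < b) = 1 - (1 - (b - a))" for a b :: nat by simp
  show ?thesis using assms unfolding decidable_def eq by (intro unary_intros)
qed

lemma decidable_le [unary_intros]: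
  assumes "unary f" "unary f'" shows "decidable (\<lambda>x. f x \<le> f' x)"
  using decidable_not[OF decidable_less[OF assms(2,1)]] by (simp add: not_less)

lemma decidable_eq [unary_intros]:
  assumes "unary f" "unary f'" shows "decidable (\<lambda>x. f x = f' x)"
  using decidable_conj[OF decidable_le decidable_le, OF assms assms(2,1)]
  by (simp add: eq_iff)

text \<open>The diagonal of \<open>pair\<close> containing \<open>z\<close> is computed by counting the diagonals completed
  before \<open>z\<close>.\<close>

lemma unary_pfst_psnd: "unary pfst" "unary psnd"
proof -
  \<comment> \<open>With truncated subtraction, the increment is 1 exactly when \<open>Suc k\<close>
    has reached the start of the next diagonal.\<close>
  define d where "d z = rec_nat 0 (\<lambda>k w. w + (1 - (triangle (Suc w) - Suc k))) z" for z
  have d: "triangle (d z) \<le> z \<and> z < triangle (Suc (d z))" for z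
  proof (induction z)
    case (Suc z)
    have "d (Suc z) = d z + (1 - (triangle (Suc (d z)) - Suc z))" by (simp add: d_def)
    moreover have "Suc z < triangle (Suc (d z)) \<or> Suc z = triangle (Suc (d z))"
      using Suc by linarith
    ultimately show ?case using Suc by fastforce
  qed (simp add: d_def)
  have unique: "w = v" if "triangle w \<le> z" "z < triangle (Suc w)" "triangle v \<le> z" "z < triangle (Suc v)"
    for w v z
  proof -
    have mono: "triangle a \<le> triangle b" if "a \<le> b" for a b
      using that by (induction rule: dec_induct) auto
    show ?thesis
      using mono[of "Suc w" v] mono[of "Suc v" w] that by linarith
  qed
  have dz: "d z = pfst z + psnd z" and pfst_z: "pfst z = z - triangle (d z)" for z
  proof -
    have z: "triangle (pfst z + psnd z) + pfst z = z"
      using pair_pfst_psnd[of z] unfolding pair_def prod_encode_def by simp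
    show dz: "d z = pfst z + psnd z"
    proof (rule unique)
      show "triangle (pfst z + psnd z) \<le> z" "z < triangle (Suc (pfst z + psnd z))"
        using z by (simp_all only: triangle_Suc)
    qed (use d in auto)
    show "pfst z = z - triangle (d z)"
      unfolding dz using z by linarith
  qed
  have "nary 1 (\<lambda>xs. rec_nat 0 (\<lambda>k w. w + (1 - (triangle (Suc w) - Suc k))) (xs ! 0))"
    by (intro nary_rec nary_proj nary_const nary_add nary_binary[OF binary_diff]
        nary_unary[OF unary_triangle0] nary_unary[OF unary_Suc0]) auto
  then have "unary d" by (simp add: unary_iff_nary d_def[abs_def])
  then have "unary (\<lambda>z. z - triangle (d z))" by (intro unary_intros)
  then show pfst: "unary pfst" by (simp add: pfst_z[abs_def])
  have "psnd z = d z - pfst z" for z by (simp add: dz)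
  then have "psnd = (\<lambda>z. d z - pfst z)" by blast
  moreover have "unary (\<lambda>z. d z - pfst z)" 
    using \<open>unary d\<close> pfst by (intro unary_intros)
  ultimately show "unary psnd" by simp
qed

lemmas unary_pfst [unary_intros] = unary_comp[OF unary_pfst_psnd(1)]
lemmas unary_psnd [unary_intros] = unary_comp[OF unary_pfst_psnd(2)]

lemma unary_comp2:
  assumes "unary (\<lambda>w. f (pfst w) (psnd w))" "unary a" "unary b"
  shows "unary (\<lambda>x. f (a x) (b x))"
  using unary_comp[OF assms(1) unary_pair[OF assms(2,3)]] by simp

lemma unary_of_bool [unary_intros]: "decidable P \<Longrightarrow> unary (\<lambda>x. of_bool (P x))"
  by (simp add: decidable_def)

lemma unary_sum [unary_intros]:
  assumes "unary (\<lambda>w. f (pfst w) (psnd w))" "unary n"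
  shows "unary (\<lambda>x. \<Sum>y<n x. f x y)"
proof -
  have "unary (\<lambda>x. rec_nat 0 (\<lambda>k r. f x k + r) (n x))"
    by (rule unary_rec[where b = "\<lambda>x k r. f x k + r"])
       (intro unary_intros unary_comp2[OF assms(1)] assms)+
  moreover have "rec_nat 0 (\<lambda>k r. f x k + r) m = (\<Sum>y<m. f x y)" for x m
    by (induction m) (auto simp: add.commute)
  ultimately show ?thesis by simp
qed

lemma unary_funpow [unary_intros]:
  assumes "unary (\<lambda>w. f (pfst w) (psnd w))" "unary n" "unary a"
  shows "unary (\<lambda>x. (f x ^^ n x) (a x))"
proof -
  have "unary (\<lambda>x. rec_nat (a x) (\<lambda>k r. f x r) (n x))"
    by (rule unary_rec[where b = "\<lambda>x k r. f x r"])
       (intro unary_intros unary_comp2[OF assms(1)] assms)+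
  moreover have "rec_nat z (\<lambda>k r. f x r) m = (f x ^^ m) z" for x m z
    by (induction m) auto
  ultimately show ?thesis by simp
qed

lemma unary_card [unary_intros]:
  assumes "decidable (\<lambda>w. P (pfst w) (psnd w))" "unary n"
  shows "unary (\<lambda>x. card {y. y < n x \<and> P x y})"
proof -
  have "card {y. y < m \<and> P x y} = (\<Sum>y<m. of_bool (P x y))" for m x
    by (simp add: Int_def)
  moreover have "unary (\<lambda>x. \<Sum>y<n x. of_bool (P x y))"
    using assms by (intro unary_intros)
  ultimately show ?thesis by simp
qed

lemma decidable_ex [unary_intros]:
  assumes "decidable (\<lambda>w. P (pfst w) (psnd w))" "unary n"
  shows "decidable (\<lambda>x. \<exists>y<n x. P x y)"
proof -
  have "(\<exists>y<m. P x y) \<longleftrightarrow> card {y. y < m \<and> P x y} \<noteq> 0" for m x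
    by auto
  moreover have "decidable (\<lambda>x. card {y. y < n x \<and> P x y} \<noteq> 0)"
    using assms by (intro unary_intros)
  ultimately show ?thesis by simp
qed

end

section \<open>A universal function\<close>

lemma pfst_psnd_less: "0 < pfst z \<Longrightarrow> pfst (psnd z) < z"
  and psnd_psnd_less: "0 < pfst z \<Longrightarrow> psnd (psnd z) < z"
  using psnd_less[of z] pfst_le[of "psnd z"] psnd_le[of "psnd z"] by linarith+

text \<open>A language of unary functions in which every number is a code and every code is total;
  its only loop is the iteration of tag 8. Recursive calls occur under positive tags only, where the
  components are smaller than the code.\<close>

function sem :: "(nat \<Rightarrow> nat) \<Rightarrow> nat \<Rightarrow> nat \<Rightarrow> nat" where
  "sem g e = (let t = pfst e; a = psnd e in
    if t = 0 then (\<lambda>x. 0)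
    else if t = 1 then Suc
    else if t = 2 then (\<lambda>x. x - 1)
    else if t = 3 then pfst
    else if t = 4 then psnd
    else if t = 5 then g
    else if t = 6 then (\<lambda>x. pair (sem g (pfst a) x) (sem g (psnd a) x))
    else if t = 7 then (\<lambda>x. sem g (pfst a) (sem g (psnd a) x))
    else if t = 8 then (\<lambda>x. (sem g a ^^ psnd x) (pfst x))
    else if t = 9 then (\<lambda>x. pair x (sem g (pfst a) (psnd a)))
    else if t = 10 then (\<lambda>x. pair a x)
    else (\<lambda>x. (sem g (pfst a) ^^ psnd a) x))"
  by pat_completeness auto
termination
proof (relation "measure snd", goal_cases)
  case 1
  then show ?case by simp
qed (simp_all add: psnd_less pfst_psnd_less psnd_psnd_less)

declare sem.simps [simp del]

lemma sem_pair:
  "sem g (pair 0 a) x = 0"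
  "sem g (pair 1 a) x = Suc x"
  "sem g (pair 2 a) x = x - 1"
  "sem g (pair 3 a) x = pfst x"
  "sem g (pair 4 a) x = psnd x"
  "sem g (pair 5 a) x = g x"
  "sem g (pair 6 a) x = pair (sem g (pfst a) x) (sem g (psnd a) x)"
  "sem g (pair 7 a) x = sem g (pfst a) (sem g (psnd a) x)"
  "sem g (pair 8 a) x = (sem g a ^^ psnd x) (pfst x)"
  "sem g (pair 9 a) x = pair x (sem g (pfst a) (psnd a))"
  "sem g (pair 10 a) x = pair a x"
  "t > 10 \<Longrightarrow> sem g (pair t a) x = (sem g (pfst a) ^^ psnd a) x"
  by (subst sem.simps, simp add: Let_def)+

section \<open>Codes for functions primitive recursive in an oracle\<close>

named_theorems coded_intros

definition coded :: "(nat \<Rightarrow> nat) \<Rightarrow> (nat \<Rightarrow> nat) \<Rightarrow> bool" where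
  "coded g f \<longleftrightarrow> (\<exists>e. \<forall>x. sem g e x = f x)"

lemma coded_zero: "coded g (\<lambda>x. 0)"
  using sem_pair(1) unfolding coded_def by blast

lemma coded_comp: "coded g f \<Longrightarrow> coded g f' \<Longrightarrow> coded g (\<lambda>x. f (f' x))"
proof -
  assume "coded g f" "coded g f'"
  then obtain e e' where "\<forall>x. sem g e x = f x" "\<forall>x. sem g e' x = f' x" by (auto simp: coded_def)
  then have "\<forall>x. sem g (pair 7 (pair e e')) x = f (f' x)" by (simp add: sem_pair)
  then show ?thesis unfolding coded_def by blast
qed

lemma coded_basic: "coded g Suc" "coded g (\<lambda>x. x - 1)" "coded g pfst" "coded g psnd" "coded g g"
  unfolding coded_def using sem_pair(2-6)[of g 0] by blast+

lemmas coded_Suc [coded_intros] = coded_comp[OF coded_basic(1)]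
  and coded_pred [coded_intros] = coded_comp[OF coded_basic(2)]
  and coded_pfst [coded_intros] = coded_comp[OF coded_basic(3)]
  and coded_psnd [coded_intros] = coded_comp[OF coded_basic(4)]

lemma coded_pair [coded_intros]: "coded g f \<Longrightarrow> coded g f' \<Longrightarrow> coded g (\<lambda>x. pair (f x) (f' x))"
proof -
  assume "coded g f" "coded g f'"
  then obtain e e' where "\<forall>x. sem g e x = f x" "\<forall>x. sem g e' x = f' x" by (auto simp: coded_def)
  then have "\<forall>x. sem g (pair 6 (pair e e')) x = pair (f x) (f' x)" by (simp add: sem_pair)
  then show ?thesis unfolding coded_def by blast
qed

lemma coded_id [coded_intros]: "coded g (\<lambda>x. x)"
  using coded_pair[OF coded_basic(3,4)] by simp

lemma coded_const [coded_intros]: "coded g (\<lambda>x. c)"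
  by (induction c) (auto intro: coded_zero coded_Suc)

lemma coded_funpow [coded_intros]:
  assumes "coded g f" "coded g n" "coded g a"
  shows "coded g (\<lambda>x. (f ^^ n x) (a x))"
proof -
  obtain e where "\<forall>x. sem g e x = f x" using assms(1) by (auto simp: coded_def)
  then have e: "sem g e = f" by auto
  have "\<forall>x. sem g (pair 8 e) x = (f ^^ psnd x) (pfst x)" by (simp add: sem_pair e)
  then have "coded g (\<lambda>x. (f ^^ psnd x) (pfst x))" unfolding coded_def by blast
  from coded_comp[OF this coded_pair[OF assms(3,2)]] show ?thesis by simp
qed

lemma coded_schemeI:
  "coded g f \<Longrightarrow> (\<And>xs y. evals g p xs y \<Longrightarrow> f (list_encode xs) = y) \<Longrightarrow>
    \<exists>f. coded g f \<and> (\<forall>xs y. evals g p xs y \<longrightarrow> f (list_encode xs) = y)"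
  by blast

text \<open>Passing tuples as list codes removes arities. The simulating function is total and is
  constrained only where the scheme has a value.\<close>

lemma coded_scheme:
  "mu_free p \<Longrightarrow> \<exists>f. coded g f \<and> (\<forall>xs y. evals g p xs y \<longrightarrow> f (list_encode xs) = y)"
proof (induction p)
  case ZeroS
  show ?case
    by (rule coded_schemeI[OF coded_const[of g 0]]) (auto elim: evals.cases)
next
  case SuccS
  have "coded g (\<lambda>x. Suc (pfst (x - 1)))" by (intro coded_intros)
  then show ?case
    by (rule coded_schemeI) (auto elim!: evals.cases[of _ SuccS] simp: list_encode_Cons_pair simp del: list_encode.simps(2))
next
  case (ProjS i)
  \<comment> \<open>\<open>psnd (z - 1)\<close> is the tail of a nonempty list code.\<close>
  have "(((\<lambda>z. psnd (z - 1)) ^^ i) (list_encode xs)) = list_encode (drop i xs)" if "i < length xs" for xs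
    using that
  proof (induction i)
    case (Suc i)
    then have "drop i xs = xs ! i # drop (Suc i) xs" by (simp add: Cons_nth_drop_Suc)
    with Suc show ?case by (simp add: list_encode_Cons_pair del: list_encode.simps(2))
  qed simp
  moreover have "list_encode (drop i xs) = Suc (pair (xs ! i) (list_encode (drop (Suc i) xs)))"
    if "i < length xs" for xs :: "nat list"
    using that by (metis Cons_nth_drop_Suc list_encode_Cons_pair)
  moreover have "coded g (\<lambda>x. pfst (((\<lambda>z. psnd (z - 1)) ^^ i) x - 1))" by (intro coded_intros)
  ultimately show ?case
    by (intro coded_schemeI) (assumption, auto elim!: evals.cases[of _ "ProjS i"])
next
  case OracleS
  have "coded g (\<lambda>x. g (pfst (x - 1)))" by (intro coded_intros coded_comp[OF coded_basic(5)])
  then show ?case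
    by (rule coded_schemeI) (auto elim!: evals.cases[of _ OracleS] simp: list_encode_Cons_pair simp del: list_encode.simps(2))
next
  case (CompS p qs)
  obtain f where f: "coded g f" "\<forall>xs y. evals g p xs y \<longrightarrow> f (list_encode xs) = y"
    using CompS by auto
  have "\<forall>q\<in>set qs. \<exists>f. coded g f \<and> (\<forall>xs y. evals g q xs y \<longrightarrow> f (list_encode xs) = y)"
    using CompS by auto
  \<comment> \<open>The argument schemes are merged into one function that returns the code of the
    whole argument list.\<close>
  then have "\<exists>h. coded g h \<and> (\<forall>xs ys. list_all2 (\<lambda>q y. evals g q xs y) qs ys \<longrightarrow> h (list_encode xs) = list_encode ys)"
  proof (induction qs)
    case Nil
    show ?case by (rule exI[of _ "\<lambda>x. 0"]) (auto intro: coded_intros)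
  next
    case (Cons q qs)
    then obtain h1 h2 where "coded g h1" "\<forall>xs y. evals g q xs y \<longrightarrow> h1 (list_encode xs) = y"
      "coded g h2" "\<forall>xs ys. list_all2 (\<lambda>q y. evals g q xs y) qs ys \<longrightarrow> h2 (list_encode xs) = list_encode ys"
      by auto
    then show ?case
      by (intro exI[of _ "\<lambda>x. Suc (pair (h1 x) (h2 x))"])
        (auto intro: coded_intros simp: list_all2_Cons1 list_encode_Cons_pair simp del: list_encode.simps(2))
  qed
  then obtain h where h: "coded g h"
    "\<forall>xs ys. list_all2 (\<lambda>q y. evals g q xs y) qs ys \<longrightarrow> h (list_encode xs) = list_encode ys" by blast
  show ?case
    using f h by (intro exI[of _ "\<lambda>x. f (h x)"])
      (auto intro: coded_comp elim!: evals.cases[of _ "CompS p qs"])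
next
  case (RecS p q)
  obtain f where f: "coded g f" "\<forall>xs y. evals g p xs y \<longrightarrow> f (list_encode xs) = y"
    using RecS by auto
  obtain h where h: "coded g h" "\<forall>xs y. evals g q xs y \<longrightarrow> h (list_encode xs) = y"
    using RecS by auto
  text \<open>The state of the iteration consists of the counter, the last value and the parameters.\<close>
  let ?st = "\<lambda>s. pair (Suc (pfst s)) (pair (h (Suc (pair (pfst s) (Suc (psnd s))))) (psnd (psnd s)))"
  have iter: "(?st ^^ n) (pair 0 (pair (f (list_encode xs)) (list_encode xs))) = pair n (pair y (list_encode xs))"
    if "evals g (RecS p q) (n # xs) y" for n xs y
    using that
  proof (induction n arbitrary: y)
    case 0
    then show ?case using f(2) by (auto elim: evals.cases)
  next
    case (Suc n)
    from Suc.prems obtain r where "evals g (RecS p q) (n # xs) r" "evals g q (n # r # xs) y"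
      by (cases rule: evals.cases) auto
    moreover have "h (list_encode (n # r # xs)) = y" using calculation(2) h(2) by blast
    ultimately show ?case
      using Suc.IH by (simp add: list_encode_Cons_pair del: list_encode.simps(2))
  qed
  have "coded g (\<lambda>x. pfst (psnd ((?st ^^ pfst (x - 1)) (pair 0 (pair (f (psnd (x - 1))) (psnd (x - 1)))))))"
    by (intro coded_intros coded_comp[OF h(1)] coded_comp[OF f(1)])
  moreover have "pfst (psnd ((?st ^^ pfst (list_encode xs - 1)) (pair 0 (pair (f (psnd (list_encode xs - 1))) (psnd (list_encode xs - 1)))))) = y"
    if ev: "evals g (RecS p q) xs y" for xs y
  proof -
    obtain n xs' where xs: "xs = n # xs'"
      using ev by cases auto
    with ev show ?thesis using iter[of n xs' y]
      by (simp add: list_encode_Cons_pair del: list_encode.simps(2))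
  qed
  ultimately show ?case by blast
qed auto

lemma coded_pr_le:
  assumes "f \<le>\<^sub>P\<^sub>R g"
  shows "coded g f"
proof -
  obtain p where p: "mu_free p" "\<And>x. evals g p [x] (f x)" using assms by (auto simp: pr_le_def)
  obtain h where h: "coded g h" "\<forall>xs y. evals g p xs y \<longrightarrow> h (list_encode xs) = y"
    using coded_scheme[OF p(1)] by blast
  have "coded g (\<lambda>x. h (Suc (pair x 0)))" by (intro coded_intros coded_comp[OF h(1)])
  moreover have "h (Suc (pair x 0)) = f x" for x
    using h(2)[rule_format, OF p(2)[of x]] by (simp add: list_encode_Cons_pair del: list_encode.simps(2))
  ultimately show ?thesis by simp
qed

section \<open>A stack machine for evaluation in steps\<close>

text \<open>The successor keeps 0 free for the empty stack.\<close>

definition push :: "nat \<Rightarrow> nat \<Rightarrow> nat" where "push e k = Suc (pair e k)"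

text \<open>A configuration \<open>pair k x\<close> consists of a value \<open>x\<close> and a stack \<open>k\<close> of codes that remain to be
  applied to it. Codes with a tag of at least 9 serve as continuations of pairing and iteration.\<close>

definition step :: "(nat \<Rightarrow> nat) \<Rightarrow> nat \<Rightarrow> nat" where
  "step g w = (let k = psnd (pfst w - 1); t = pfst (pfst (pfst w - 1)); a = psnd (pfst (pfst w - 1));
      x = psnd w in
    if pfst w = 0 then w
    else if t = 0 then pair k 0
    else if t = 1 then pair k (Suc x)
    else if t = 2 then pair k (x - 1)
    else if t = 3 then pair k (pfst x)
    else if t = 4 then pair k (psnd x)
    else if t = 5 then pair k (g x)
    else if t = 6 then pair (push (pfst a) (push (pair 9 (pair (psnd a) x)) k)) x
    else if t = 7 then pair (push (psnd a) (push (pfst a) k)) x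
    else if t = 8 then pair (push (pair 11 (pair a (psnd x))) k) (pfst x)
    else if t = 9 then pair (push (pfst a) (push (pair 10 x) k)) (psnd a)
    else if t = 10 then pair k (pair a x)
    else if psnd a = 0 then pair k x
    else pair (push (pfst a) (push (pair 11 (pair (pfst a) (psnd a - 1))) k)) x)"

lemma step_halted: "pfst w = 0 \<Longrightarrow> (step g ^^ n) w = w"
  by (induction n) (auto simp: step_def)

definition reaches :: "(nat \<Rightarrow> nat) \<Rightarrow> nat \<Rightarrow> nat \<Rightarrow> bool" where
  "reaches g w w' \<longleftrightarrow> (\<exists>n. (step g ^^ n) w = w')"

lemma reaches_refl: "reaches g w w"
  unfolding reaches_def by (rule exI[of _ 0]) simp

lemma reaches_trans: "reaches g w w' \<Longrightarrow> reaches g w' w'' \<Longrightarrow> reaches g w w''"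
  unfolding reaches_def by (metis funpow_add comp_apply)

lemma reaches_step: "reaches g (step g w) w' \<Longrightarrow> reaches g w w'"
  unfolding reaches_def by (metis funpow_Suc_right comp_apply)

text \<open>Strong induction on the code with an arbitrary stack below it: evaluating a code acts as
  a subroutine call that leaves \<open>k\<close> intact, so calls can be chained.\<close>

lemma reaches_sem: "reaches g (pair (push e k) x) (pair k (sem g e x))"
proof (induction e arbitrary: k x rule: less_induct)
  case (less e)
  obtain t a where e: "e = pair t a" by (metis pair_pfst_psnd)
  have IH: "reaches g (pair (push e' k) x) (pair k (sem g e' x))" if "e' < e" for e' k x
    using less that .
  have a: "a < e" "pfst a < e" "psnd a < e" if "t > 0"
    using psnd_less[of e] that pfst_le[of a] psnd_le[of a] unfolding e by simp_all
  \<comment> \<open>A continuation also stores run-time data and may exceed \<open>e\<close>, so the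
    induction hypothesis need not apply to it. It suffices that the code inside it is smaller than
    \<open>e\<close>.\<close>
  have iter: "reaches g (pair (push (pair 11 (pair b n)) k) x) (pair k ((sem g b ^^ n) x))"
    if b: "b < e" for b n k x
  proof (induction n arbitrary: x)
    case 0
    show ?case by (rule reaches_step) (simp add: step_def push_def reaches_refl)
  next
    case (Suc n)
    show ?case
      by (rule reaches_step)
        (simp add: step_def push_def funpow_Suc_right reaches_trans[OF IH[OF b, unfolded push_def] Suc[unfolded push_def]]
          del: funpow.simps)
  qed
  have cont: "reaches g (pair (push (pair 9 (pair r x)) k) y) (pair k (pair y (sem g r x)))"
    if "r < e" for r x k y
    by (rule reaches_step, simp add: step_def push_def)
      (rule reaches_trans[OF IH[OF that, unfolded push_def]], rule reaches_step,
       simp add: step_def push_def reaches_refl)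

  consider "t \<le> 5" | "t = 6" | "t = 7" | "t = 8" | "t = 9" | "t = 10" | "t > 10" by linarith
  then show ?case
  proof cases
    case 1
    then have "t = 0 \<or> t = 1 \<or> t = 2 \<or> t = 3 \<or> t = 4 \<or> t = 5" by linarith
    then have "step g (pair (push e k) x) = pair k (sem g e x)"
      by (elim disjE) (simp_all add: step_def push_def e sem_pair(1-6)[where a = a, simplified])
    then show ?thesis by - (rule reaches_step, simp add: reaches_refl)
  next
    case 2
    have "reaches g (pair (push (pfst a) (push (pair 9 (pair (psnd a) x)) k)) x)
       (pair k (pair (sem g (pfst a) x) (sem g (psnd a) x)))"
      using 2 a by (intro reaches_trans[OF IH cont]) auto
    with 2 show ?thesis by - (rule reaches_step, simp add: step_def push_def e sem_pair)
  next
    case 3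
    have "reaches g (pair (push (psnd a) (push (pfst a) k)) x) (pair k (sem g (pfst a) (sem g (psnd a) x)))"
      using 3 a by (intro reaches_trans[OF IH IH]) auto
    with 3 show ?thesis by - (rule reaches_step, simp add: step_def push_def e sem_pair)
  next
    case 4
    with iter[OF a(1), where k = k and n = "psnd x" and x = "pfst x"] show ?thesis
      by - (rule reaches_step, simp add: step_def push_def e sem_pair)
  next
    case 5
    with cont[OF a(2), where x = "psnd a" and k = k and y = x] show ?thesis
      by (simp add: e sem_pair)
  next
    case 6
    then show ?thesis
      by - (rule reaches_step, simp add: step_def push_def e sem_pair reaches_refl)
  next
    case 7
    then show ?thesis
    proof (cases "psnd a")
      case 0
      with 7 show ?thesis by - (rule reaches_step, simp add: step_def push_def e sem_pair reaches_refl)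
    next
      case (Suc n)
      have "reaches g (pair (push (pfst a) (push (pair 11 (pair (pfst a) n)) k)) x)
         (pair k ((sem g (pfst a) ^^ n) (sem g (pfst a) x)))"
        using 7 a by (intro reaches_trans[OF IH iter]) auto
      with 7 Suc show ?thesis
        by - (rule reaches_step, simp add: step_def push_def e sem_pair funpow_Suc_right del: funpow.simps)
    qed
  qed
qed

text \<open>0 means that the machine is still running after \<open>s\<close> steps,
  \<open>Suc v\<close> that it has halted with value \<open>v\<close>. The step bound keeps
  evaluation primitive recursive in the oracle.\<close>

definition univ :: "(nat \<Rightarrow> nat) \<Rightarrow> nat \<Rightarrow> nat \<Rightarrow> nat \<Rightarrow> nat" where
  "univ g e x s = (let w = (step g ^^ s) (pair (push e 0) x) in if pfst w = 0 then Suc (psnd w) else 0)"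

lemma univ_eventually: "\<exists>s0. \<forall>s\<ge>s0. univ g e x s = Suc (sem g e x)"
proof -
  obtain s0 where s0: "(step g ^^ s0) (pair (push e 0) x) = pair 0 (sem g e x)"
    using reaches_sem[of g e 0 x] by (auto simp: reaches_def)
  have "univ g e x s = Suc (sem g e x)" if "s \<ge> s0" for s
  proof -
    obtain n where n: "s = n + s0" using \<open>s \<ge> s0\<close> by (metis add.commute le_Suc_ex)
    have "(step g ^^ s) (pair (push e 0) x) = pair 0 (sem g e x)"
      unfolding n funpow_add comp_apply s0 by (rule step_halted) simp
    then show ?thesis by (simp add: univ_def)
  qed
  then show ?thesis by blast
qed

lemma univ_mono:
  assumes "univ g e x s \<noteq> 0" "s \<le> s'"
  shows "univ g e x s' = univ g e x s"
proof -
  obtain n where n: "s' = n + s" using \<open>s \<le> s'\<close> by (metis add.commute le_Suc_ex)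
  have "pfst ((step g ^^ s) (pair (push e 0) x)) = 0"
    using assms(1) by (auto simp: univ_def Let_def split: if_splits)
  then have "(step g ^^ s') (pair (push e 0) x) = (step g ^^ s) (pair (push e 0) x)"
    unfolding n funpow_add comp_apply by (rule step_halted)
  then show ?thesis by (simp add: univ_def)
qed

lemma univ_value: "univ g e x s \<noteq> 0 \<Longrightarrow> univ g e x s = Suc (sem g e x)"
  using univ_eventually[of g e x] univ_mono[of g e x s] by (metis nle_le)

context scheme_class
begin

lemma unary_univ:
  assumes "unary h" "unary e" "unary x" "unary s"
  shows "unary (\<lambda>z. univ h (e z) (x z) (s z))"
proof -
  have "unary (\<lambda>w. step h w)"
    unfolding step_def Let_def push_def by (intro unary_intros unary_comp[OF assms(1)])
  note step = unary_comp[OF this]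
  show ?thesis
    unfolding univ_def Let_def push_def by (intro unary_intros step assms)
qed

end

section \<open>Primitive recursive, relatively primitive recursive and computable functions\<close>

context scheme_class
begin

lemma primrec_unary:
  assumes "primrec_fun f" shows "unary f"
  using assms evals_oracle_free[of "\<lambda>_. 0" _ _ _ g] K_base
  unfolding primrec_fun_def unary_def by metis

end

interpretation pr: scheme_class "\<lambda>p. mu_free p \<and> oracle_free p" "\<lambda>_. 0"
  by standard auto

interpretation comp: scheme_class oracle_free "\<lambda>_. 0"
  by standard auto

lemma scheme_class_rel: "scheme_class mu_free"
  by standard auto

lemma primrec_iff: "primrec_fun f \<longleftrightarrow> pr.unary f"
  by (simp add: primrec_fun_def pr.unary_def conj_assoc)

lemma computable_iff: "computable_fun f \<longleftrightarrow> comp.unary f"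
  by (simp add: computable_fun_def comp.unary_def)

lemma pr_le_iff: "f \<le>\<^sub>P\<^sub>R h \<longleftrightarrow> scheme_class.unary mu_free h f"
  by (simp add: pr_le_def scheme_class.unary_def[OF scheme_class_rel])

lemma pr_le_refl: "h \<le>\<^sub>P\<^sub>R h"
  using equiv_pr_equiv by (auto simp: equiv_def refl_on_def pr_equiv_def)

lemma pr_le_trans: "f \<le>\<^sub>P\<^sub>R f' \<Longrightarrow> f' \<le>\<^sub>P\<^sub>R f'' \<Longrightarrow> f \<le>\<^sub>P\<^sub>R f''"
proof -
  assume "f \<le>\<^sub>P\<^sub>R f'" "f' \<le>\<^sub>P\<^sub>R f''"
  then obtain p q where "mu_free p" "\<forall>x. evals f' p [x] (f x)" "mu_free q" "\<forall>x. evals f'' q [x] (f' x)"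
    by (auto simp: pr_le_def)
  then show ?thesis
    unfolding pr_le_def by (intro exI[of _ "oracle_subst q p"]) (simp add: evals_oracle_subst mu_free_oracle_subst)
qed

lemma pr_le_degree_class: "pr_le_degree f (pr_equiv `` {h}) \<longleftrightarrow> f \<le>\<^sub>P\<^sub>R h"
  unfolding pr_le_degree_def pr_equiv_def by (auto intro: pr_le_trans pr_le_refl)

lemma primrec_coded:
  assumes "primrec_fun f" shows "coded (\<lambda>_. 0) f"
  using assms by (intro coded_pr_le) (auto simp: primrec_fun_def pr_le_def)

lemma comp_unary_Least:
  assumes "comp.decidable (\<lambda>w. P (pfst w) (psnd w))" "\<And>x. \<exists>y. P x y"
  shows "comp.unary (\<lambda>x. LEAST y. P x y)"
proof -
  \<comment> \<open>\<open>MuS\<close> searches for a zero in its first argument: hence the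
    complemented indicator here and the exchanged arguments below.\<close>
  have "comp.unary (\<lambda>w. 1 - of_bool (P (pfst w) (psnd w)))"
    by (intro unary_intros assms)
  then have "comp.nary 2 (\<lambda>xs. 1 - of_bool (P (pfst (pair (xs ! 1) (xs ! 0))) (psnd (pair (xs ! 1) (xs ! 0)))))"
    by (rule comp.nary_unary) (intro comp.nary_pair comp.nary_proj, simp_all)
  then obtain p where p: "oracle_free p"
      "\<And>xs. length xs = 2 \<Longrightarrow> evals (\<lambda>_. 0) p xs (1 - of_bool (P (xs ! 1) (xs ! 0)))"
    by (auto simp: comp.nary_def)
  have p': "evals (\<lambda>_. 0) p [y, x] (1 - of_bool (P x y))" for x y
    using p(2)[of "[y, x]"] by simp
  have "evals (\<lambda>_. 0) (MuS p) [x] (LEAST y. P x y)" for x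
  proof (rule evals.mu)
    show "evals (\<lambda>_. 0) p [LEAST y. P x y, x] 0"
      using p'[of "LEAST y. P x y" x] LeastI_ex[OF assms(2)[of x]] by simp
    show "\<forall>m<LEAST y. P x y. \<exists>k. evals (\<lambda>_. 0) p [m, x] (Suc k)"
    proof (intro allI impI exI)
      fix m assume "m < (LEAST y. P x y)"
      then show "evals (\<lambda>_. 0) p [m, x] (Suc 0)"
        using p'[of m x] not_less_Least[of m "P x"] by simp
    qed
  qed
  then show ?thesis unfolding comp.unary_def using p(1) by (intro exI[of _ "MuS p"]) auto
qed

section \<open>Counters\<close>

definition ticking :: "(nat \<Rightarrow> nat) \<Rightarrow> bool" where
  "ticking c \<longleftrightarrow> c 0 = 0 \<and> (\<forall>s. c (Suc s) = c s \<or> c (Suc s) = Suc (c s)) \<and> (\<forall>n. \<exists>s. n \<le> c s)"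

text \<open>A ticking counter that moves becomes positive, so 0 is free to mark the idle
  steps.\<close>

definition tick :: "(nat \<Rightarrow> nat) \<Rightarrow> nat \<Rightarrow> nat" where
  "tick c s = (if c (Suc s) = c s then 0 else c (Suc s))"

definition tick_time :: "(nat \<Rightarrow> nat) \<Rightarrow> nat \<Rightarrow> nat" where
  "tick_time c n = (THE s. tick c s = n)"

lemma ticking_mono:
  assumes "ticking c" "s \<le> s'" shows "c s \<le> c s'"
proof (rule lift_Suc_mono_le[OF _ \<open>s \<le> s'\<close>])
  show "c n \<le> c (Suc n)" for n
    using assms(1) unfolding ticking_def by (metis le_SucI order_refl)
qed

lemma ticking_Least:
  assumes "ticking c"
  shows "c (LEAST s. n \<le> c s) = n"
proof -
  obtain s0 where s0: "n \<le> c s0" using assms by (auto simp: ticking_def)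
  define s where "s = (LEAST s. n \<le> c s)"
  have le: "n \<le> c s" unfolding s_def using s0 by (rule LeastI)
  show ?thesis
  proof (cases s)
    case 0
    then show ?thesis using assms le by (simp add: ticking_def flip: s_def)
  next
    case (Suc s')
    then have "\<not> n \<le> c s'" using not_less_Least[of s' "\<lambda>s. n \<le> c s"] by (simp flip: s_def)
    then show ?thesis using assms le Suc unfolding ticking_def s_def[symmetric]
      by (metis le_antisym not_less_eq_eq)
  qed
qed

lemma tick_ex1:
  assumes c: "ticking c" and n: "0 < n" "n \<le> c i"
  shows "\<exists>s<i. tick c s = n" "\<exists>!s. tick c s = n"
proof -
  define s where "s = (LEAST s. n \<le> c s)"
  have cs: "c s = n" unfolding s_def using c by (rule ticking_Least)
  with c n obtain s' where s': "s = Suc s'" unfolding ticking_def by (metis not0_implies_Suc less_irrefl)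
  then have "\<not> n \<le> c s'" using not_less_Least[of s' "\<lambda>s. n \<le> c s"] by (simp flip: s_def)
  then have tick: "tick c s' = n" using cs s' by (auto simp: tick_def)
  have "s \<le> i" unfolding s_def using n by (intro Least_le)
  then show "\<exists>s<i. tick c s = n" using tick s' by (intro exI[of _ s']) auto
  have less: False if "x < y" "tick c x = n" "tick c y = n" for x y
  proof -
    have "n = c (Suc x)" "n = Suc (c y)"
      using that n c unfolding tick_def ticking_def by (metis less_irrefl)+
    then show False using ticking_mono[OF c, of "Suc x" y] that(1) by simp
  qed
  then have "x = s'" if "tick c x = n" for x
    using that tick less[of x s'] less[of s' x] by (cases x s' rule: linorder_cases) auto
  then show "\<exists>!s. tick c s = n" using tick by auto
qed

text \<open>The sum has at most one nonzero summand; it expresses the bounded search for the tick as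
  a primitive recursive term.\<close>

lemma tick_time:
  assumes "ticking c" "0 < n" "n \<le> c i"
  shows "tick c s = n \<longleftrightarrow> s = tick_time c n" "tick_time c n < i"
    "(\<Sum>s<i. if tick c s = n then s else 0) = tick_time c n"
proof -
  show *: "tick c s = n \<longleftrightarrow> s = tick_time c n" for s
    using theI'[OF tick_ex1(2)[OF assms]] tick_ex1(2)[OF assms] unfolding tick_time_def by metis
  show "tick_time c n < i" using tick_ex1(1)[OF assms] * by auto
  then show "(\<Sum>s<i. if tick c s = n then s else 0) = tick_time c n"
    by (simp add: *)
qed

text \<open>The counter cannot get stuck: as long as its value is \<open>n\<close>, its guard holds
  at every late enough stage.\<close>

lemma ticking_rec:
  assumes c: "c = rec_nat 0 (\<lambda>s v. if P v s then Suc v else v)"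
    and ev: "\<And>n. \<exists>s0. \<forall>s\<ge>s0. c s = n \<longrightarrow> P n s"
  shows "ticking c"
proof -
  have c0: "c 0 = 0" and cS: "c (Suc s) = (if P (c s) s then Suc (c s) else c s)" for s
    by (simp_all add: c)
  have mono: "c s \<le> c s'" if "s \<le> s'" for s s'
    using that by (rule lift_Suc_mono_le[rotated]) (simp add: cS)
  have "\<exists>s. n \<le> c s" for n
  proof (induction n)
    case (Suc n)
    then obtain s1 where s1: "n \<le> c s1" by blast
    obtain s0 where s0: "\<forall>s\<ge>s0. c s = n \<longrightarrow> P n s" using ev by blast
    define s where "s = max s0 s1"
    have "n \<le> c s" using s1 mono[of s1 s] by (simp add: s_def)
    moreover have "c s = n \<Longrightarrow> c (Suc s) = Suc n" using s0 by (simp add: cS s_def)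
    ultimately show ?case by (metis Suc_leI le_neq_implies_less order_refl)
  qed simp
  then show ?thesis using c0 cS by (auto simp: ticking_def)
qed

section \<open>The structures\<close>

text \<open>Bit \<open>pair e k\<close> refutes the value that code \<open>e\<close> predicts for it at the argument \<open>k\<close>.\<close>

definition dbit :: "nat \<Rightarrow> bool" where
  "dbit m \<longleftrightarrow> sem (\<lambda>_. 0) (pfst m) (list_encode [pair 1 m, psnd m]) \<noteq> 1"

text \<open>0 means that the prediction is not evaluated yet, and 2 is the successor of 1, the only
  prediction that makes the bit false.\<close>

definition dbit_at :: "nat \<Rightarrow> nat \<Rightarrow> nat" where
  "dbit_at m s = univ (\<lambda>_. 0) (pfst m) (list_encode [pair 1 m, psnd m]) s"

lemma dbit_at: "dbit_at m s \<noteq> 0 \<Longrightarrow> dbit_at m s \<noteq> 2 \<longleftrightarrow> dbit m"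
  unfolding dbit_at_def dbit_def using univ_value by fastforce

lemma dbit_at_mono: "dbit_at m s \<noteq> 0 \<Longrightarrow> s \<le> s' \<Longrightarrow> dbit_at m s' \<noteq> 0"
  unfolding dbit_at_def using univ_mono by metis

definition fast :: "nat \<Rightarrow> nat" where
  "fast = rec_nat 0 (\<lambda>s v. if dbit_at v s \<noteq> 0 then Suc v else v)"

lemma ticking_fast: "ticking fast"
proof (rule ticking_rec[OF fast_def])
  show "\<exists>s0. \<forall>s\<ge>s0. fast s = n \<longrightarrow> dbit_at n s \<noteq> 0" for n
    unfolding dbit_at_def using univ_eventually by (metis nat.distinct(1))
qed

text \<open>This makes the relations primitive recursive: once \<open>fast\<close> has passed
  \<open>j\<close>, bit \<open>j\<close> can be read off.\<close>

lemma fast_dbit_at: "j < fast s \<Longrightarrow> dbit_at j s \<noteq> 0"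
proof (induction s)
  case (Suc s)
  have "fast (Suc s) = (if dbit_at (fast s) s \<noteq> 0 then Suc (fast s) else fast s)"
    by (simp add: fast_def)
  with Suc show ?case
    by (metis dbit_at_mono le_SucI less_SucE order_refl)
qed (simp add: fast_def)

text \<open>The \<open>n\<close>-th step of this counter waits until code \<open>pfst n\<close> has been evaluated at the time of
  the corresponding step of \<open>fast\<close>, and until the result has been exceeded.\<close>

definition slow_guard :: "nat \<Rightarrow> nat \<Rightarrow> nat" where
  "slow_guard n i = univ (\<lambda>_. 0) (pfst n) (\<Sum>s<i. if tick fast s = Suc n then s else 0) i"

definition slow :: "nat \<Rightarrow> nat" where
  "slow = rec_nat 0 (\<lambda>i n. if n < fast i \<and> slow_guard n i \<noteq> 0 \<and> slow_guard n i \<le> i then Suc n else n)"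

lemma slow_guard:
  "n < fast i \<Longrightarrow> slow_guard n i = univ (\<lambda>_. 0) (pfst n) (tick_time fast (Suc n)) i"
  unfolding slow_guard_def using tick_time(3)[OF ticking_fast, of "Suc n" i] by simp

lemma ticking_slow: "ticking slow"
proof (rule ticking_rec[OF slow_def])
  fix n
  obtain s1 where s1: "Suc n \<le> fast s1" using ticking_fast by (auto simp: ticking_def)
  obtain s2 where s2: "\<forall>s\<ge>s2. univ (\<lambda>_. 0) (pfst n) (tick_time fast (Suc n)) s
      = Suc (sem (\<lambda>_. 0) (pfst n) (tick_time fast (Suc n)))" (is "\<forall>s\<ge>s2. _ = ?v")
    using univ_eventually by blast
  \<comment> \<open>From \<open>s1\<close> on \<open>fast\<close> exceeds \<open>n\<close>, from
    \<open>s2\<close> on the evaluation has halted, and from \<open>?v\<close> on the result is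
    exceeded.\<close>
  have "n < fast s \<and> slow_guard n s \<noteq> 0 \<and> slow_guard n s \<le> s" if "s \<ge> s1 + s2 + ?v" for s
  proof -
    have "n < fast s" using s1 ticking_mono[OF ticking_fast, of s1 s] that by simp
    then show ?thesis using s2 that by (simp add: slow_guard)
  qed
  then show "\<exists>s0. \<forall>s\<ge>s0. slow s = n \<longrightarrow> n < fast s \<and> slow_guard n s \<noteq> 0 \<and> slow_guard n s \<le> s"
    by blast
qed

lemma slow_Suc: "slow (Suc i) = (if slow i < fast i \<and> slow_guard (slow i) i \<noteq> 0 \<and> slow_guard (slow i) i \<le> i
    then Suc (slow i) else slow i)"
  by (simp add: slow_def)

lemma slow_le_fast: "slow i \<le> fast i"
proof (induction i)
  case (Suc i)
  then show ?case using ticking_mono[OF ticking_fast, of i "Suc i"] by (auto simp: slow_Suc)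
qed (simp add: slow_def)

text \<open>When \<open>slow\<close> moves to \<open>Suc n\<close>, the stage is at least the guard,
  which is the successor of the result. Since every code is \<open>pfst n\<close> for some
  \<open>n\<close>, no code maps all tick times of \<open>fast\<close> to those of
  \<open>slow\<close>.\<close>

lemma sem_less_tick_time_slow:
  "sem (\<lambda>_. 0) (pfst n) (tick_time fast (Suc n)) < tick_time slow (Suc n)"
proof -
  obtain i0 where "Suc n \<le> slow i0" using ticking_slow by (auto simp: ticking_def)
  define i where "i = tick_time slow (Suc n)"
  have "tick slow i = Suc n"
    using tick_time(1)[OF ticking_slow _ \<open>Suc n \<le> slow i0\<close>] by (simp add: i_def)
  then have "slow (Suc i) = Suc n" "slow (Suc i) \<noteq> slow i"
    by (auto simp: tick_def split: if_splits)
  then have *: "slow i = n" "n < fast i" "slow_guard n i \<noteq> 0" "slow_guard n i \<le> i"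
    by (auto simp: slow_Suc split: if_splits)
  then show ?thesis
    using univ_value[of "\<lambda>_. 0" "pfst n" "tick_time fast (Suc n)" i] by (simp add: slow_guard i_def)
qed

context scheme_class
begin

lemma unary_dbit_at [unary_intros]: "unary m \<Longrightarrow> unary s \<Longrightarrow> unary (\<lambda>x. dbit_at (m x) (s x))"
  unfolding dbit_at_def list_encode_Cons_pair list_encode.simps(1)
  by (intro unary_intros unary_univ)

lemma unary_fast [unary_intros]: "unary s \<Longrightarrow> unary (\<lambda>x. fast (s x))"
  unfolding fast_def by (intro unary_intros)

lemma unary_tick_fast [unary_intros]: "unary s \<Longrightarrow> unary (\<lambda>x. tick fast (s x))"
  unfolding tick_def by (intro unary_intros)

lemma unary_slow_guard [unary_intros]:
  "unary n \<Longrightarrow> unary s \<Longrightarrow> unary (\<lambda>x. slow_guard (n x) (s x))"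
proof -
  assume ns: "unary n" "unary s"
  have "unary (\<lambda>w. slow_guard (pfst w) (psnd w))"
    unfolding slow_guard_def by (intro unary_intros unary_univ)
  from unary_comp2[OF this ns] show ?thesis .
qed

lemma unary_slow [unary_intros]: "unary s \<Longrightarrow> unary (\<lambda>x. slow (s x))"
  unfolding slow_def by (intro unary_intros)

end

section \<open>The language and its counter structures\<close>

text \<open>Indices with \<open>slow i = 0\<close> name no constant, because type 0 does not single
  out an element.\<close>

definition the_lang :: lang where
  "the_lang = \<lparr>fun_syms = {i. 0 < slow i}, rel_syms = UNIV, fun_arity = \<lambda>_. 0, rel_arity = \<lambda>_. 1\<rparr>"

text \<open>Element \<open>s\<close> has the type \<open>tick c s\<close>. The relation symbol \<open>pair 0 j\<close> says that the type exceeds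
  \<open>j\<close>, and \<open>pair v j\<close> for \<open>v > 0\<close> that moreover \<open>dbit j\<close> holds; constant \<open>i\<close> names the element
  of type \<open>slow i\<close>.\<close>

definition counter_struc :: "(nat \<Rightarrow> nat) \<Rightarrow> struc" where
  "counter_struc c = \<lparr>fun_int = \<lambda>i xs. tick_time c (slow i),
     rel_int = \<lambda>r xs. psnd r < tick c (hd xs) \<and> (pfst r = 0 \<or> dbit (psnd r))\<rparr>"

text \<open>An intrinsic description of a copy: the symbols \<open>pair 0 j\<close> determine
  \<open>N\<close>, so types are preserved by isomorphisms. Typed copies with infinitely many
  elements of type 0 will turn out to be isomorphic.\<close>

definition typing :: "struc \<Rightarrow> (nat \<Rightarrow> nat) \<Rightarrow> bool" where
  "typing B N \<longleftrightarrow>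
     (\<forall>r x. rel_int B r [x] \<longleftrightarrow> psnd r < N x \<and> (pfst r = 0 \<or> dbit (psnd r))) \<and>
     (\<forall>n>0. \<exists>!x. N x = n) \<and> (\<forall>i. 0 < slow i \<longrightarrow> N (fun_int B i []) = slow i)"

lemma uniformly_presented_the_lang:
  "uniformly_presented C the_lang B \<longleftrightarrow>
     (\<exists>\<phi>. C \<phi> \<and> (\<forall>i. 0 < slow i \<longrightarrow> fun_int B i [] = \<phi> (list_encode [i]))) \<and>
     (\<exists>\<rho>. C \<rho> \<and> (\<forall>r x. of_bool (rel_int B r [x]) = \<rho> (list_encode [r, x])))"
proof -
  have "(\<forall>xs. length xs = Suc 0 \<longrightarrow> P xs) \<longleftrightarrow> (\<forall>x. P [x])" for P :: "nat list \<Rightarrow> bool"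
    by (auto simp: length_Suc_conv)
  then show ?thesis unfolding uniformly_presented_def the_lang_def by simp
qed

lemma isomorphism_the_lang:
  "isomorphism the_lang A B f \<longleftrightarrow> bij f \<and>
     (\<forall>i. 0 < slow i \<longrightarrow> f (fun_int A i []) = fun_int B i []) \<and>
     (\<forall>r x. rel_int A r [x] \<longleftrightarrow> rel_int B r [f x])"
proof -
  have "(\<forall>xs. length xs = Suc 0 \<longrightarrow> P xs) \<longleftrightarrow> (\<forall>x. P [x])" for P :: "nat list \<Rightarrow> bool"
    by (auto simp: length_Suc_conv)
  then show ?thesis unfolding isomorphism_def the_lang_def by simp
qed

lemma primrec_the_lang: "primrec_lang the_lang"
  unfolding primrec_lang_def the_lang_def primrec_iff
  by (simp, intro conjI unary_intros)

lemma typing_counter_struc: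
  assumes "ticking c" shows "typing (counter_struc c) (tick c)"
proof -
  have "\<exists>!x. tick c x = n" if "n > 0" for n
  proof -
    obtain i where "n \<le> c i" using assms by (auto simp: ticking_def)
    then show ?thesis using tick_ex1(2)[OF assms that] by blast
  qed
  moreover have "tick c (tick_time c n) = n" if "n > 0" for n
  proof -
    obtain i where "n \<le> c i" using assms by (auto simp: ticking_def)
    then show ?thesis using tick_time(1)[OF assms that] by blast
  qed
  ultimately show ?thesis by (auto simp: typing_def counter_struc_def)
qed

text \<open>The lower bound on \<open>c\<close> places the element named by constant
  \<open>i\<close> below \<open>i\<close>; the upper bound guarantees that an element appears only
  after the bits it reveals are decided.\<close>

lemma punctual_counter_struc:
  assumes c: "ticking c" "primrec_fun c" and le: "\<And>i. slow i \<le> c i" "\<And>i. c i \<le> fast i"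
  shows "punctual the_lang (counter_struc c)"
proof -
  have "pr.unary c" using c by (simp add: primrec_iff)
  note c' = pr.unary_comp[OF this]
  have "pr.unary (\<lambda>z. \<Sum>s<pfst (z - 1). if tick c s = slow (pfst (z - 1)) then s else 0)"
    unfolding tick_def by (intro unary_intros c')
  moreover have "fun_int (counter_struc c) i [] =
      (\<Sum>s<pfst (list_encode [i] - 1). if tick c s = slow (pfst (list_encode [i] - 1)) then s else 0)"
    if "0 < slow i" for i
    using tick_time(3)[OF c(1) that le(1)] by (simp add: counter_struc_def list_encode_Cons_pair del: list_encode.simps(2))
  moreover have "pr.unary (\<lambda>z. of_bool (psnd (pfst (z - 1)) < tick c (pfst (psnd (z - 1) - 1)) \<and>
      (pfst (pfst (z - 1)) = 0 \<or> dbit_at (psnd (pfst (z - 1))) (Suc (pfst (psnd (z - 1) - 1))) \<noteq> 2)))"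
    unfolding tick_def by (intro unary_intros c')
  \<comment> \<open>Element \<open>x\<close> takes its type from the counter at
    \<open>Suc x\<close>, so the bits are consulted at that stage.\<close>
  moreover have "dbit_at j (Suc x) \<noteq> 2 \<longleftrightarrow> dbit j" if "j < tick c x" for j x
  proof -
    have "j < fast (Suc x)" using that le(2)[of "Suc x"] by (auto simp: tick_def split: if_splits)
    then show ?thesis by (intro dbit_at fast_dbit_at)
  qed
  then have "of_bool (rel_int (counter_struc c) r [x]) =
      (\<lambda>z. of_bool (psnd (pfst (z - 1)) < tick c (pfst (psnd (z - 1) - 1)) \<and>
      (pfst (pfst (z - 1)) = 0 \<or> dbit_at (psnd (pfst (z - 1))) (Suc (pfst (psnd (z - 1) - 1))) \<noteq> 2)))
      (list_encode [r, x])" for r x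
    by (auto simp: counter_struc_def list_encode_Cons_pair simp del: list_encode.simps(2))
  ultimately show ?thesis
    unfolding punctual_def uniformly_presented_the_lang primrec_iff by blast
qed

lemma typing_isomorphic:
  assumes "typing A N" "isomorphism the_lang A B f"
  shows "typing B (N \<circ> inv f)" "{x. (N \<circ> inv f) x = 0} = f ` {x. N x = 0}"
proof -
  have f: "bij f" "\<And>i. 0 < slow i \<Longrightarrow> f (fun_int A i []) = fun_int B i []"
     "\<And>r x. rel_int A r [x] \<longleftrightarrow> rel_int B r [f x]"
    using assms(2) by (auto simp: isomorphism_the_lang)
  have inv: "inv f (f x) = x" "f (inv f y) = y" for x y
    using f(1) by (simp_all add: bij_is_inj bij_is_surj surj_f_inv_f)
  have "\<exists>!y. N (inv f y) = n" if "n > 0" for n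
  proof -
    have "\<exists>!x. N x = n" using assms(1) that by (simp add: typing_def)
    then show ?thesis by (metis inv)
  qed
  moreover have "inv f (fun_int B i []) = fun_int A i []" if "0 < slow i" for i
    using f(2)[OF that] inv(1) by metis
  moreover have "rel_int B r [y] \<longleftrightarrow> rel_int A r [inv f y]" for r y
    using f(3)[of r "inv f y"] inv(2) by simp
  ultimately show "typing B (N \<circ> inv f)"
    using assms(1) by (auto simp: typing_def)
  show "{x. (N \<circ> inv f) x = 0} = f ` {x. N x = 0}"
    using inv by (auto simp: image_iff) metis
qed

lemma isomorphism_if_typing:
  assumes "typing B N" "typing C N'" "bij f" "\<And>x. N' (f x) = N x"
  shows "isomorphism the_lang B C f"
  unfolding isomorphism_the_lang
proof (intro conjI allI impI)
  fix i assume i: "0 < slow i"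
  have "N' (f (fun_int B i [])) = slow i" "N' (fun_int C i []) = slow i"
    using assms i by (auto simp: typing_def)
  then show "f (fun_int B i []) = fun_int C i []"
    using assms(2) i unfolding typing_def by metis
qed (use assms in \<open>auto simp: typing_def\<close>)

lemma card_less_enumerate:
  fixes S :: "nat set"
  assumes "infinite S"
  shows "card {y. y < enumerate S k \<and> y \<in> S} = k"
proof -
  have "{y. y < enumerate S k \<and> y \<in> S} = enumerate S ` {..<k}"
  proof (intro set_eqI iffI)
    fix y assume "y \<in> {y. y < enumerate S k \<and> y \<in> S}"
    moreover obtain i where "y = enumerate S i" using calculation enumerate_Ex[OF assms] by blast
    ultimately show "y \<in> enumerate S ` {..<k}" using assms by simp
  qed (use assms in \<open>auto simp: enumerate_in_set\<close>)
  then show ?thesis by (simp add: card_image inj_on_subset[OF inj_enumerate[OF assms]])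
qed

text \<open>Replaces the recursion behind \<open>enumerate\<close> by a counting condition that a
  search can test.\<close>

lemma eq_enumerate_iff:
  fixes S :: "nat set"
  assumes "infinite S"
  shows "y \<in> S \<and> card {z. z < y \<and> z \<in> S} = k \<longleftrightarrow> y = enumerate S k"
  using card_less_enumerate[OF assms] enumerate_in_set[OF assms] enumerate_Ex[OF assms] by metis

section \<open>Isomorphisms that preserve types\<close>

definition slow_time :: "nat \<Rightarrow> nat" where
  "slow_time n = (LEAST i. n \<le> slow i)"

lemma slow_slow_time: "slow (slow_time n) = n"
  unfolding slow_time_def using ticking_slow by (rule ticking_Least)

text \<open>Elements of type 0 are matched in increasing order, all others through the first
  constant of their type. The inverse has the same form with the copies exchanged.\<close>

definition transfer :: "(nat \<Rightarrow> nat) \<Rightarrow> (nat \<Rightarrow> nat) \<Rightarrow> struc \<Rightarrow> nat \<Rightarrow> nat" where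
  "transfer N N' C x = (if N x = 0 then enumerate {y. N' y = 0} (card {y. y < x \<and> N y = 0})
     else fun_int C (slow_time (N x)) [])"

lemma typing_transfer:
  assumes "typing C N'" "infinite {y. N' y = 0}"
  shows "N' (transfer N N' C x) = N x"
proof (cases "N x = 0")
  case True
  then show ?thesis using enumerate_in_set[OF assms(2)] by (simp add: transfer_def)
next
  case False
  then show ?thesis using assms(1) slow_slow_time[of "N x"] by (simp add: transfer_def typing_def)
qed

lemma transfer_transfer:
  assumes B: "typing B N" "infinite {y. N y = 0}" and C: "typing C N'" "infinite {y. N' y = 0}"
  shows "transfer N' N B (transfer N N' C x) = x"
proof (cases "N x = 0")
  case True
  have "enumerate {y. N y = 0} (card {y. y < x \<and> N y = 0}) = x"
    using eq_enumerate_iff[OF B(2), of x "card {y. y < x \<and> N y = 0}"] True by simp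
  moreover have "card {z. z < transfer N N' C x \<and> N' z = 0} = card {y. y < x \<and> N y = 0}"
    using card_less_enumerate[OF C(2)] True by (simp add: transfer_def)
  ultimately show ?thesis
    using typing_transfer[OF C, of N x] True by (simp add: transfer_def[of N' N])
next
  case False
  have "N (transfer N' N B (transfer N N' C x)) = N x"
    by (simp add: typing_transfer B C)
  then show ?thesis using B(1) False unfolding typing_def by (metis neq0_conv)
qed

lemma isomorphism_transfer:
  assumes B: "typing B N" "infinite {y. N y = 0}" and C: "typing C N'" "infinite {y. N' y = 0}"
  shows "isomorphism the_lang B C (transfer N N' C)" "inv (transfer N N' C) = transfer N' N B"
proof -
  have "bij (transfer N N' C)"
    using transfer_transfer[OF B C] transfer_transfer[OF C B] by (intro o_bij[of "transfer N' N B"] ext) simp_all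
  then show "isomorphism the_lang B C (transfer N N' C)"
    using isomorphism_if_typing[OF B(1) C(1)] typing_transfer[OF C] by blast
  show "inv (transfer N N' C) = transfer N' N B"
    using transfer_transfer[OF B C] transfer_transfer[OF C B] by (intro inv_unique_comp ext) simp_all
qed

context scheme_class
begin

text \<open>Serves both for computable copies and, relative to \<open>slow_time\<close>, for
  punctual ones.\<close>

lemma unary_transfer:
  assumes "unary N" "unary (enumerate {y. N' y = 0})" "unary slow_time"
    and "unary \<phi>" "\<And>i. 0 < slow i \<Longrightarrow> fun_int C i [] = \<phi> (list_encode [i])"
  shows "unary (transfer N N' C)"
proof -
  have "transfer N N' C = (\<lambda>x. if N x = 0 then enumerate {y. N' y = 0} (card {y. y < x \<and> N y = 0})
     else \<phi> (Suc (pair (slow_time (N x)) 0)))"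
    by (auto simp: transfer_def assms(5) slow_slow_time list_encode_Cons_pair simp del: list_encode.simps(2))
  moreover have "unary (\<lambda>x. if N x = 0 then enumerate {y. N' y = 0} (card {y. y < x \<and> N y = 0})
     else \<phi> (Suc (pair (slow_time (N x)) 0)))"
    by (intro unary_intros unary_comp[OF assms(1)] unary_comp[OF assms(2)] unary_comp[OF assms(3)]
      unary_comp[OF assms(4)])
  ultimately show ?thesis by simp
qed

end

text \<open>At \<open>m = pair e k\<close>, where \<open>e\<close> codes the search for an element up to \<open>2 * m\<close> that claims
  \<open>dbit m\<close>, an element of type above \<open>m\<close> in this range would force \<open>dbit m\<close> to differ from itself.\<close>

lemma typing_bound:
  assumes B: "typing B N" and \<rho>: "primrec_fun \<rho>"
    "\<And>r x. of_bool (rel_int B r [x]) = \<rho> (list_encode [r, x])"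
  shows "\<exists>e. \<forall>k. \<forall>x\<le>2 * pair e k. N x \<le> pair e k"
proof -
  \<comment> \<open>On the code of \<open>[pair 1 m, k]\<close>, the number \<open>m\<close> is
    recovered from the relation symbol and \<open>k\<close> is ignored, so a single code
    \<open>e\<close> yields infinitely many numbers \<open>m = pair e k\<close>.\<close>
  define \<sigma> where "\<sigma> z = (of_bool (\<exists>x<Suc (psnd (pfst (z - 1)) + psnd (pfst (z - 1))).
    \<rho> (list_encode [pfst (z - 1), x]) = 1) :: nat)" for z
  have "pr.unary \<rho>" using \<rho>(1) by (simp add: primrec_iff)
  then have "pr.unary \<sigma>"
    unfolding \<sigma>_def[abs_def] list_encode_Cons_pair list_encode.simps(1)
    by (intro unary_intros pr.unary_comp[OF \<open>pr.unary \<rho>\<close>])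
  then obtain e where e: "\<And>x. sem (\<lambda>_. 0) e x = \<sigma> x"
    using primrec_coded[of \<sigma>] by (auto simp: primrec_iff coded_def)
  have "N x \<le> pair e k" if x: "x \<le> 2 * pair e k" for k x
  proof (rule ccontr)
    define m where "m = pair e k"
    assume "\<not> N x \<le> pair e k"
    then have Nx: "m < N x" by (simp add: m_def)
    have "rel_int B (pair 1 m) [x] \<longleftrightarrow> \<rho> (list_encode [pair 1 m, x]) = 1" for x
      using \<rho>(2)[of "pair 1 m" x] by (cases "rel_int B (pair 1 m) [x]") auto
    moreover have "rel_int B (pair 1 m) [x] \<longleftrightarrow> m < N x \<and> dbit m" for x
      using B by (simp add: typing_def)
    ultimately have "\<sigma> (list_encode [pair 1 m, k]) = of_bool (\<exists>x<Suc (m + m). m < N x \<and> dbit m)"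
      by (simp add: \<sigma>_def list_encode_Cons_pair del: list_encode.simps(2))
    moreover have "\<exists>x<Suc (m + m). m < N x" using Nx x by (auto simp: m_def less_Suc_eq_le mult_2)
    moreover have "dbit m \<longleftrightarrow> \<sigma> (list_encode [pair 1 m, k]) \<noteq> 1"
      by (simp add: dbit_def e m_def)
    \<comment> \<open>If the bit holds, the search succeeds and refutes it; if not, the search fails
      and the bit is true by definition.\<close>
    ultimately show False by (cases "dbit m") auto
  qed
  then show ?thesis by blast
qed

section \<open>Punctual and computable copies\<close>

lemma sum_of_bool_less: "n \<le> b \<Longrightarrow> (\<Sum>j<b. of_bool (j < n)) = (n :: nat)"
  by (simp add: Int_absorb1 flip: lessThan_def)

lemma typing_punctual:
  assumes B: "typing B N" and p: "punctual the_lang B"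
  shows "infinite {x. N x = 0}" "pr.unary N" "pr.unary (enumerate {x. N x = 0})"
proof -
  obtain \<rho> where \<rho>: "primrec_fun \<rho>" "\<And>r x. of_bool (rel_int B r [x]) = \<rho> (list_encode [r, x])"
    using p unfolding punctual_def uniformly_presented_the_lang by blast
  obtain e where e: "\<And>k x. x \<le> 2 * pair e k \<Longrightarrow> N x \<le> pair e k"
    using typing_bound[OF B \<rho>] by blast
  have inj: "x = y" if "N x = N y" "N x > 0" for x y
    using B that unfolding typing_def by metis
  \<comment> \<open>Among the \<open>2 * m + 1\<close> elements up to \<open>2 * m\<close>, with
    \<open>m = pair e k\<close>, at most \<open>m\<close> have positive type, since these types are
    distinct and at most \<open>m\<close>. More than \<open>m \<ge> k\<close> elements of type 0
    remain.\<close>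
  have many: "k < card {x. x < Suc (2 * pair e k) \<and> x \<in> {x. N x = 0}}" for k
  proof -
    let ?m = "pair e k"
    let ?P = "{x. x < Suc (2 * ?m) \<and> N x = 0}" and ?Q = "{x. x < Suc (2 * ?m) \<and> N x \<noteq> 0}"
    have "card ?Q \<le> card {1..?m}"
    proof (rule card_inj_on_le)
      show "inj_on N ?Q" using inj by (auto simp: inj_on_def)
      show "N ` ?Q \<subseteq> {1..?m}" using e by (auto simp: less_Suc_eq_le Suc_le_eq)
    qed simp
    moreover have "?P \<union> ?Q = {..<Suc (2 * ?m)}" by auto
    moreover have "card ?P + card ?Q = card (?P \<union> ?Q)"
      by (rule card_Un_disjoint[symmetric]) auto
    ultimately show ?thesis using le_pair_2[of k e] by simp
  qed
  show inf: "infinite {x. N x = 0}"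
  proof
    assume "finite {x. N x = 0}"
    then have "card {x. x < Suc (2 * pair e k) \<and> x \<in> {x. N x = 0}} \<le> card {x. N x = 0}" for k
      by (intro card_mono) auto
    with many show False by (meson leD)
  qed
  have \<rho>_unary: "pr.unary \<rho>" using \<rho>(1) by (simp add: primrec_iff)
  have "\<rho> (list_encode [pair 0 j, x]) = of_bool (j < N x)" for j x
    using \<rho>(2)[of "pair 0 j" x] B by (simp add: typing_def)
  \<comment> \<open>As \<open>x \<le> pair e x\<close>, the bound on types applies to
    \<open>x\<close> with \<open>k = x\<close>, and \<open>N x\<close> is obtained by counting
    positive answers.\<close>
  moreover have "N x \<le> Suc (pair e x)" for x
    using e[of x x] le_pair_2[of x e] by linarith
  ultimately have "N x = (\<Sum>j<Suc (pair e x). \<rho> (list_encode [pair 0 j, x]))" for x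
    using sum_of_bool_less[of "N x" "Suc (pair e x)"] by simp
  then have "N = (\<lambda>x. \<Sum>j<Suc (pair e x). \<rho> (list_encode [pair 0 j, x]))" by blast
  moreover have "pr.unary (\<lambda>x. \<Sum>j<Suc (pair e x). \<rho> (list_encode [pair 0 j, x]))"
    unfolding list_encode_Cons_pair list_encode.simps(1)
    by (intro unary_intros pr.unary_comp[OF \<rho>_unary])
  ultimately show N: "pr.unary N" by simp
  \<comment> \<open>Turns the search for the \<open>k\<close>-th element of type 0 into a bounded
    one.\<close>
  have le: "enumerate {x. N x = 0} k < Suc (pair e k + pair e k)" for k
  proof (rule ccontr)
    assume "\<not> enumerate {x. N x = 0} k < Suc (pair e k + pair e k)"
    then have "card {x. x < Suc (2 * pair e k) \<and> x \<in> {x. N x = 0}}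
        \<le> card {x. x < enumerate {x. N x = 0} k \<and> x \<in> {x. N x = 0}}"
      by (intro card_mono) auto
    with many[of k] show False by (simp only: card_less_enumerate[OF inf])
  qed
  have "enumerate {x. N x = 0} k =
      (\<Sum>y<Suc (pair e k + pair e k). if N y = 0 \<and> card {z. z < y \<and> N z = 0} = k then y else 0)" for k
  proof -
    have "(N y = 0 \<and> card {z. z < y \<and> N z = 0} = k) = (y = enumerate {x. N x = 0} k)" for y
      using eq_enumerate_iff[OF inf, of y k] by simp
    with le[of k] show ?thesis by simp
  qed
  then have "enumerate {x. N x = 0} = (\<lambda>k.
      \<Sum>y<Suc (pair e k + pair e k). if N y = 0 \<and> card {z. z < y \<and> N z = 0} = k then y else 0)" by blast
  moreover have "pr.unary (\<lambda>k.
      \<Sum>y<Suc (pair e k + pair e k). if N y = 0 \<and> card {z. z < y \<and> N z = 0} = k then y else 0)"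
    by (intro unary_intros pr.unary_comp[OF N])
  ultimately show "pr.unary (enumerate {x. N x = 0})" by simp
qed

text \<open>Here unbounded searches replace the diagonal bound: the type is the first
  \<open>j\<close> with a negative answer, and infinitude makes the search for elements of type 0
  terminate.\<close>

lemma typing_computable:
  assumes B: "typing B N" and c: "computable_struc the_lang B" and inf: "infinite {x. N x = 0}"
  shows "comp.unary N" "comp.unary (enumerate {x. N x = 0})"
proof -
  obtain \<rho> where \<rho>: "computable_fun \<rho>" "\<And>r x. of_bool (rel_int B r [x]) = \<rho> (list_encode [r, x])"
    using c unfolding computable_struc_def uniformly_presented_the_lang by blast
  have \<rho>_unary: "comp.unary \<rho>" using \<rho>(1) by (simp add: computable_iff)
  have \<rho>_eq: "\<rho> (list_encode [pair 0 j, x]) = 0 \<longleftrightarrow> N x \<le> j" for j x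
    using \<rho>(2)[of "pair 0 j" x, symmetric] B by (auto simp: typing_def)
  have "N = (\<lambda>x. LEAST j. \<rho> (list_encode [pair 0 j, x]) = 0)"
    unfolding \<rho>_eq by (auto intro!: Least_equality[symmetric])
  moreover have "comp.unary (\<lambda>x. LEAST j. \<rho> (list_encode [pair 0 j, x]) = 0)"
  proof (rule comp_unary_Least)
    show "\<exists>j. \<rho> (list_encode [pair 0 j, x]) = 0" for x unfolding \<rho>_eq by blast
    show "comp.decidable (\<lambda>w. \<rho> (list_encode [pair 0 (psnd w), pfst w]) = 0)"
      unfolding list_encode_Cons_pair list_encode.simps(1)
      by (intro unary_intros comp.unary_comp[OF \<rho>_unary])
  qed
  ultimately show N: "comp.unary N" by simp
  have eq: "N y = 0 \<and> card {z. z < y \<and> N z = 0} = k \<longleftrightarrow> y = enumerate {x. N x = 0} k" for y k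
    using eq_enumerate_iff[OF inf, of y k] by simp
  have "enumerate {x. N x = 0} = (\<lambda>k. LEAST y. N y = 0 \<and> card {z. z < y \<and> N z = 0} = k)"
    unfolding eq by (auto intro!: Least_equality[symmetric])
  moreover have "comp.unary (\<lambda>k. LEAST y. N y = 0 \<and> card {z. z < y \<and> N z = 0} = k)"
  proof (rule comp_unary_Least)
    show "\<exists>y. N y = 0 \<and> card {z. z < y \<and> N z = 0} = k" for k unfolding eq by blast
    show "comp.decidable (\<lambda>w. N (psnd w) = 0 \<and> card {z. z < psnd w \<and> N z = 0} = pfst w)"
      by (intro unary_intros comp.unary_comp[OF N])
  qed
  ultimately show "comp.unary (enumerate {x. N x = 0})" by simp
qed

lemma computable_slow_time: "comp.unary slow_time"
  unfolding slow_time_def[abs_def]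
proof (rule comp_unary_Least)
  show "\<exists>i. n \<le> slow i" for n using ticking_slow by (simp add: ticking_def)
  show "comp.decidable (\<lambda>w. pfst w \<le> slow (psnd w))" by (intro unary_intros)
qed

lemma punctual_fast: "punctual the_lang (counter_struc fast)"
proof (rule punctual_counter_struc[OF ticking_fast _ slow_le_fast])
  have "pr.unary (\<lambda>s. fast s)" by (intro unary_intros)
  then show "primrec_fun fast" by (simp add: primrec_iff)
qed simp

lemma punctual_slow: "punctual the_lang (counter_struc slow)"
proof (rule punctual_counter_struc[OF ticking_slow _ _ slow_le_fast])
  have "pr.unary (\<lambda>s. slow s)" by (intro unary_intros)
  then show "primrec_fun slow" by (simp add: primrec_iff)
qed simp

lemmas typing_fast = typing_counter_struc[OF ticking_fast]
  and typing_slow = typing_counter_struc[OF ticking_slow]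

text \<open>Infinitude holds in the fast copy because that copy is punctual, and is carried over by
  the isomorphism even to copies that are not.\<close>

lemma typing_copy:
  assumes "isomorphic the_lang (counter_struc fast) B"
  obtains N where "typing B N" "infinite {x. N x = 0}"
proof -
  obtain f where f: "isomorphism the_lang (counter_struc fast) B f"
    using assms by (auto simp: isomorphic_def)
  then have "inj f" by (simp add: isomorphism_def bij_is_inj)
  then have "infinite (f ` {x. tick fast x = 0})"
    using typing_punctual(1)[OF typing_fast punctual_fast] by (simp add: finite_image_iff inj_on_subset)
  then show thesis
    using that[of "tick fast \<circ> inv f"] typing_isomorphic[OF typing_fast f] by simp
qed

section \<open>Categoricity and the spectrum of the fast copy\<close>

lemma computably_categorical_fast: "computably_categorical the_lang (counter_struc fast)"
  unfolding computably_categorical_def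
proof (intro allI impI, elim conjE)
  fix B C
  assume B: "computable_struc the_lang B" "isomorphic the_lang (counter_struc fast) B"
    and C: "computable_struc the_lang C" "isomorphic the_lang (counter_struc fast) C"
  obtain N where N: "typing B N" "infinite {x. N x = 0}" using typing_copy[OF B(2)] .
  obtain N' where N': "typing C N'" "infinite {x. N' x = 0}" using typing_copy[OF C(2)] .
  obtain \<phi> where "comp.unary \<phi>" "\<And>i. 0 < slow i \<Longrightarrow> fun_int C i [] = \<phi> (list_encode [i])"
    using C(1) unfolding computable_struc_def uniformly_presented_the_lang computable_iff by blast
  then have "computable_fun (transfer N N' C)"
    using typing_computable[OF N(1) B(1) N(2)] typing_computable[OF N'(1) C(1) N'(2)]
      computable_slow_time unfolding computable_iff by (intro comp.unary_transfer)
  then show "\<exists>f. isomorphism the_lang B C f \<and> computable_fun f"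
    using isomorphism_transfer(1)[OF N N'] by blast
qed

lemma isomorphism_typing_eq:
  assumes "typing A N" "typing B N'" "isomorphism the_lang A B f"
  shows "N' (f x) = N x"
proof -
  have "rel_int A (pair 0 j) [x] \<longleftrightarrow> rel_int B (pair 0 j) [f x]" for j
    using assms(3) by (simp add: isomorphism_the_lang)
  then have "j < N x \<longleftrightarrow> j < N' (f x)" for j
    using assms(1,2) by (simp add: typing_def)
  then show ?thesis by (metis less_irrefl linorder_neqE_nat)
qed

lemma not_punctually_categorical_fast: "\<not> punctually_categorical the_lang (counter_struc fast)"
proof
  assume pc: "punctually_categorical the_lang (counter_struc fast)"
  have "isomorphic the_lang (counter_struc fast) (counter_struc slow)"
    unfolding isomorphic_def
    using isomorphism_transfer(1)[OF typing_fast typing_punctual(1)[OF typing_fast punctual_fast]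
      typing_slow typing_punctual(1)[OF typing_slow punctual_slow]] by blast
  then obtain f where f: "isomorphism the_lang (counter_struc fast) (counter_struc slow) f" "primrec_fun f"
    using pc punctual_slow by (auto simp: punctually_categorical_def punctually_isomorphic_def)
  obtain e where e: "\<And>x. sem (\<lambda>_. 0) e x = f x"
    using primrec_coded[OF f(2)] by (auto simp: coded_def)
  \<comment> \<open>For this type, \<open>slow\<close> waited for code \<open>e\<close> itself,
    evaluated at the element of type \<open>n\<close> in the fast copy.\<close>
  define n where "n = Suc (pair e 0)"
  obtain i where i: "n \<le> fast i" using ticking_fast unfolding ticking_def by blast
  obtain i' where i': "n \<le> slow i'" using ticking_slow unfolding ticking_def by blast
  have "tick slow (f (tick_time fast n)) = n"
    using isomorphism_typing_eq[OF typing_fast typing_slow f(1)] tick_time(1)[OF ticking_fast _ i]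
    by (simp add: n_def)
  then have "f (tick_time fast n) = tick_time slow n"
    using tick_time(1)[OF ticking_slow _ i'] by (simp add: n_def)
  then show False
    using sem_less_tick_time_slow[of "pair e 0"] by (simp add: e n_def)
qed

text \<open>Between punctual copies, every ingredient of the transfer map except
  \<open>slow_time\<close> is primitive recursive.\<close>

lemma slow_time_in_PRCatSpec: "pr_equiv `` {slow_time} \<in> PRCatSpec the_lang (counter_struc fast)"
  unfolding PRCatSpec_def mem_Collect_eq pr_le_degree_class
proof (intro conjI allI impI; (elim conjE)?)
  show "pr_equiv `` {slow_time} \<in> pr_degrees" by (simp add: pr_degrees_def quotientI)
  fix B assume B: "punctual the_lang B" "isomorphic the_lang (counter_struc fast) B"
  interpret rel: scheme_class mu_free slow_time by (rule scheme_class_rel)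
  have slow_time: "rel.unary slow_time"
    unfolding pr_le_iff[symmetric] by (rule pr_le_refl)
  let ?A = "counter_struc fast" and ?N = "tick fast"
  obtain N where N: "typing B N" using typing_copy[OF B(2)] .
  \<comment> \<open>Stated for any two punctual copies, since the inverse is the transfer in the
    other direction.\<close>
  have transfer: "rel.unary (transfer N N' C)"
    if BC: "typing B N" "punctual the_lang B" "typing C N'" "punctual the_lang C" for N N' B C
  proof -
    obtain \<phi> where "primrec_fun \<phi>" "\<And>i. 0 < slow i \<Longrightarrow> fun_int C i [] = \<phi> (list_encode [i])"
      using BC(4) unfolding punctual_def uniformly_presented_the_lang by blast
    moreover have "primrec_fun N" "primrec_fun (enumerate {x. N' x = 0})"
      unfolding primrec_iff using typing_punctual[OF BC(1,2)] typing_punctual[OF BC(3,4)] by simp_all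
    ultimately show ?thesis
      using slow_time by (intro rel.unary_transfer) (simp_all add: rel.primrec_unary)
  qed
  note iso = isomorphism_transfer[OF typing_fast typing_punctual(1)[OF typing_fast punctual_fast]
      N typing_punctual(1)[OF N B(1)]]
  show "\<exists>f. isomorphism the_lang ?A B f \<and> f \<le>\<^sub>P\<^sub>R slow_time \<and> inv f \<le>\<^sub>P\<^sub>R slow_time"
    using iso(1) transfer[OF typing_fast punctual_fast N B(1)] transfer[OF N B(1) typing_fast punctual_fast]
    unfolding pr_le_iff iso(2)[symmetric] by blast
qed

section \<open>A degree outside the cone\<close>

text \<open>The codes with oracle \<open>r\<close> cover all functions primitive recursive in
  \<open>r\<close>, and their diagonal is computable by waiting for the step machine to
  halt.\<close>

lemma ex_computable_not_pr_le:
  assumes "computable_fun r"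
  shows "\<exists>f. computable_fun f \<and> \<not> f \<le>\<^sub>P\<^sub>R r"
proof -
  define f where "f e = Suc (sem r e e)" for e
  define time where "time e = (LEAST s. univ r e e s \<noteq> 0)" for e
  have r: "comp.unary r" using assms by (simp add: computable_iff)
  have halts: "\<exists>s. univ r e e s \<noteq> 0" for e
    using univ_eventually[of r e e] by (metis nat.distinct(1) order_refl)
  have "comp.unary time"
    unfolding time_def[abs_def]
    by (rule comp_unary_Least) (intro unary_intros comp.unary_univ r, rule halts)
  then have "comp.unary (\<lambda>e. univ r e e (time e))"
    by (intro comp.unary_univ r unary_intros)
  moreover have "univ r e e (time e) = f e" for e
    unfolding f_def time_def by (rule univ_value) (rule LeastI_ex[OF halts])
  ultimately have "computable_fun f" by (simp add: computable_iff)
  moreover have "\<not> f \<le>\<^sub>P\<^sub>R r"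
  proof
    assume "f \<le>\<^sub>P\<^sub>R r"
    then obtain e where "\<And>x. sem r e x = f x"
      using coded_pr_le[of f r] by (auto simp: coded_def)
    from this[of e] show False by (simp add: f_def)
  qed
  ultimately show ?thesis by blast
qed

theorem theorem3p1:
  shows "\<exists>L A. primrec_lang L \<and> punctual L A \<and>
    computably_categorical L A \<and> \<not> punctually_categorical L A \<and>
    \<not> PRCatSpec L A \<subseteq> cone_Delta01"
proof -
  obtain f where "computable_fun f" "\<not> f \<le>\<^sub>P\<^sub>R slow_time"
    using ex_computable_not_pr_le computable_slow_time by (auto simp: computable_iff)
  then have "pr_equiv `` {slow_time} \<notin> cone_Delta01"
    by (auto simp: cone_Delta01_def pr_le_degree_class)
  then show ?thesis
    using primrec_the_lang punctual_fast computably_categorical_fast not_punctually_categorical_fast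
      slow_time_in_PRCatSpec by blast
qed

end
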